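(* Let $$\mathbf{A}_0=\begin{pmatrix}0&1&0&0\\0&0&0&0\\0&0&0&1\\0&0&-1&0\end{pmatrix},\qquad \mathbf{C}(\Omega,\delta_1,\delta_2)=\begin{pmatrix}0&0&0&0\\-\Omega&-\delta_1&0&0\\0&0&0&0\\0&0&0&-\delta_2\end{pmatrix}.$$ Then the three-parameter real family $\mathbf{A}_0+\mathbf{C}(\Omega,\delta_1,\delta_2)$, with $(\Omega,\delta_1,\delta_2)$ in a neighbourhood of $0\in\mathbb{R}^3$, is a miniversal deformation of $\mathbf{A}_0$ up to time rescaling (as defined in the context); in particular the minimal number of parameters is $3$. Moreover its parameters are related to those of the family $$\mathbf{A}_0(\alpha)=\begin{pmatrix}0&1&0&0\\ \alpha_1&\alpha_2&0&0\\0&0&\alpha_3&-1\\0&0&1&\alpha_3\end{pmatrix},\qquad \alpha=(\alpha_1,\alpha_2,\alpha_3)\in\mathbb{R}^3,$$ as follows: there exist, for $(\Omega,\delta_1,\delta_2)$ near $0$, a real-analytic map $(\Omega,\delta_1,\delta_2)\mapsto\alpha$ fixing $0$ and invertible at the origin, a real-analytic positive function $s(\Omega,\delta_1,\delta_2)$ with $s(0)=1$, and a real-analytic family of invertible real matrices $T(\Omega,\delta_1,\delta_2)$, such that $$s\,\bigl(\mathbf{A}_0+\mathbf{C}(\Omega,\delta_1,\delta_2)\bigr)=T\,\mathbf{A}_0(\alpha)\,T^{-1},$$ and $$\alpha_1=-\Omega+\cdots,\qquad \alpha_2=-\delta_1+\cdots,\qquad \alpha_3=-\tfrac12\delta_2+\cdots,$$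 where $\cdots$ denotes terms of order at least two in $(\Omega,\delta_1,\delta_2)$.
   Context: A deformation of a real $n\times n$ matrix $A_0$ is the germ at $0$ of a real-analytic map $\mu\mapsto A(\mu)$ from a neighbourhood of $0$ in some $\mathbb{R}^k$ to the real $n\times n$ matrices, with $A(0)=A_0$. Since the matrices are linear parts of differential equations $\dot{\mathbf y}=A\mathbf y+\cdots$, rescaling time multiplies the matrix by a positive real number; matrices are considered up to such rescaling together with similarity. A deformation $A(\alpha)$, $\alpha$ near $0\in\mathbb{R}^l$, of $A_0$ is versal up to time rescaling if for every deformation $B(\mu)$, $\mu$ near $0\in\mathbb{R}^k$, of $A_0$ there exist germs at $0$ of real-analytic maps: $\varphi:\mathbb{R}^k\to\mathbb{R}^l$ with $\varphi(0)=0$, a positive scalar function $s$ with $s(0)=1$, and a matrix function $C(\mu)$ with $C(0)=I$, such that $s(\mu)B(\mu)=C(\mu)A(\varphi(\mu))C(\mu)^{-1}$ for all $\mu$ near $0$. It is miniversal up to time rescaling if, in addition, the number $l$ of its parameters is minimal among all deformations of $A_0$ versal up to time rescaling. *)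

theory Defs
  imports "HOL-Analysis.Analysis"
begin

text \<open>
  The number of parameters of a deformation is quantified over, so \<open>\<real>\<^sup>k\<close> is
  \<^term>\<open>topspace (Euclidean_space k)\<close>, that is, the functions from \<^typ>\<open>nat\<close> to \<^typ>\<open>real\<close> that
  vanish at all indices \<open>\<ge> k\<close>. A germ at the origin is represented by a total function; its values
  away from a neighbourhood of the origin in \<^term>\<open>Euclidean_space k\<close> are never used.
\<close>

definition origin :: "nat \<Rightarrow> real" where
  "origin = (\<lambda>i. 0)"

definition multi_indices :: "nat \<Rightarrow> (nat \<Rightarrow> nat) set" where
  "multi_indices k = {m. \<forall>i\<ge>k. m i = 0}"

text \<open>
  The sum over multi-indices is unordered; for values in a finite-dimensional space this means
  absolute convergence.
\<close>

definition has_power_series_at ::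
  "nat \<Rightarrow> ((nat \<Rightarrow> real) \<Rightarrow> 'b::real_normed_vector) \<Rightarrow> (nat \<Rightarrow> real) \<Rightarrow> ((nat \<Rightarrow> nat) \<Rightarrow> 'b) \<Rightarrow> bool"
where
  "has_power_series_at k f a c \<longleftrightarrow>
    (\<exists>U. openin (Euclidean_space k) U \<and> a \<in> U \<and>
      (\<forall>x\<in>U. ((\<lambda>m. (\<Prod>i<k. (x i - a i) ^ m i) *\<^sub>R c m) has_sum f x) (multi_indices k)))"

definition real_analytic_germ ::
  "nat \<Rightarrow> ((nat \<Rightarrow> real) \<Rightarrow> 'b::real_normed_vector) \<Rightarrow> bool" where
  "real_analytic_germ k f \<longleftrightarrow>
    (\<exists>U. openin (Euclidean_space k) U \<and> origin \<in> U \<and>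
      (\<forall>a\<in>U. \<exists>c. has_power_series_at k f a c))"

text \<open>Germs at the origin of real-analytic maps from \<open>\<real>\<^sup>k\<close> to \<open>\<real>\<^sup>l\<close> fixing the origin.\<close>

definition real_analytic_map_germ ::
  "nat \<Rightarrow> nat \<Rightarrow> ((nat \<Rightarrow> real) \<Rightarrow> (nat \<Rightarrow> real)) \<Rightarrow> bool" where
  "real_analytic_map_germ k l \<phi> \<longleftrightarrow>
    \<phi> origin = origin \<and>
    (\<exists>U. openin (Euclidean_space k) U \<and> origin \<in> U \<and>
      (\<forall>x\<in>U. \<phi> x \<in> topspace (Euclidean_space l))) \<and>
    (\<forall>i<l. real_analytic_germ k (\<lambda>x. \<phi> x i))"

definition terms_of_order_at_least ::
  "nat \<Rightarrow> nat \<Rightarrow> ((nat \<Rightarrow> real) \<Rightarrow> real) \<Rightarrow> bool" where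
  "terms_of_order_at_least k d f \<longleftrightarrow>
    (\<exists>c. has_power_series_at k f origin c \<and>
      (\<forall>m\<in>multi_indices k. (\<Sum>i<k. m i) < d \<longrightarrow> c m = 0))"

definition deformation ::
  "real^'n^'n \<Rightarrow> nat \<Rightarrow> ((nat \<Rightarrow> real) \<Rightarrow> real^'n^'n) \<Rightarrow> bool" where
  "deformation M k A \<longleftrightarrow> real_analytic_germ k A \<and> A origin = M"

definition versal_up_to_time_rescaling ::
  "real^'n^'n \<Rightarrow> nat \<Rightarrow> ((nat \<Rightarrow> real) \<Rightarrow> real^'n^'n) \<Rightarrow> bool" where
  "versal_up_to_time_rescaling M l A \<longleftrightarrow>
    deformation M l A \<and>
    (\<forall>k B. deformation M k B \<longrightarrow>
      (\<exists>\<phi> (s :: (nat \<Rightarrow> real) \<Rightarrow> real) (C :: (nat \<Rightarrow> real) \<Rightarrow> real^'n^'n).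
        real_analytic_map_germ k l \<phi> \<and>
        real_analytic_germ k s \<and> s origin = 1 \<and>
        real_analytic_germ k C \<and> C origin = mat 1 \<and>
        (\<exists>U. openin (Euclidean_space k) U \<and> origin \<in> U \<and>
          (\<forall>\<mu>\<in>U. s \<mu> > 0 \<and> invertible (C \<mu>) \<and>
            s \<mu> *\<^sub>R B \<mu> = C \<mu> ** A (\<phi> \<mu>) ** matrix_inv (C \<mu>)))))"

definition miniversal_up_to_time_rescaling ::
  "real^'n^'n \<Rightarrow> nat \<Rightarrow> ((nat \<Rightarrow> real) \<Rightarrow> real^'n^'n) \<Rightarrow> bool" where
  "miniversal_up_to_time_rescaling M l A \<longleftrightarrow>
    versal_up_to_time_rescaling M l A \<and>
    (\<forall>l' A'. versal_up_to_time_rescaling M l' A' \<longrightarrow> l \<le> l')"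

definition A0 :: "real^4^4" where
  "A0 = vector [vector [0, 1,  0, 0],
                vector [0, 0,  0, 0],
                vector [0, 0,  0, 1],
                vector [0, 0, -1, 0]]"

definition damping_matrix :: "real \<Rightarrow> real \<Rightarrow> real \<Rightarrow> real^4^4" where
  "damping_matrix \<Omega> \<delta>1 \<delta>2 =
     vector [vector [ 0,   0,  0,  0],
             vector [-\<Omega>, -\<delta>1, 0,  0],
             vector [ 0,   0,  0,  0],
             vector [ 0,   0,  0, -\<delta>2]]"

text \<open>
  At \<open>\<alpha> = 0\<close> this is not \<^const>\<open>A0\<close>: the lower right block has the opposite sign, so the
  two families can only be related by a conjugation that is not the identity at the origin.
\<close>

definition A0_family :: "real \<Rightarrow> real \<Rightarrow> real \<Rightarrow> real^4^4" where
  "A0_family \<alpha>1 \<alpha>2 \<alpha>3 =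
     vector [vector [0,  1,  0,   0],
             vector [\<alpha>1, \<alpha>2, 0,   0],
             vector [0,  0,  \<alpha>3, -1],
             vector [0,  0,  1,  \<alpha>3]]"

end

theory Submission
  imports Defs "HOL-Homology.Invariance_of_Domain"
begin

text \<open>
  Germs of analytic functions are handled through the weighted norm \<open>\<Sum> \<bar>c m\<bar> r\<^bsup>|m|\<^esup>\<close> of their
  coefficients: it is submultiplicative and compatible with infinite sums, which yields recentering,
  composition with power series, and a contraction argument for quadratic fixed-point equations.

  Versality: a matrix \<open>B\<close> near \<open>A0\<close> keeps the cyclic vector \<open>w\<close> of \<open>A0\<close>. Its characteristic polynomial
  factors analytically as \<open>q r\<close> with \<open>q\<close> near \<open>\<lambda>\<^sup>2\<close> and \<open>r\<close> near \<open>\<lambda>\<^sup>2 + 1\<close>, by the contraction argument.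
  The vectors \<open>r(B) w\<close> and \<open>q(B) w\<close> generate the two invariant planes, in which \<open>B\<close> takes companion
  form; time is rescaled so that \<open>r\<close> has constant term 1.

  Minimality: the trace identities for similar matrices show that the parameter map from the
  three-parameter family into any versal deformation is injective, so invariance of domain bounds
  the number of parameters from below.
\<close>

section \<open>Power series with weighted summable coefficients\<close>

text \<open>Why three: \<open>A0\<close> is nonderogatory, so its centralizer has dimension 4 and
  similarity alone leaves four invariants, the coefficients of q and r. Rescaling time by s
  multiplies the linear coefficients by s and the constant terms by s^2; the constant term of r is
  near 1, so it can be normalized away. In the lower bound this works backwards: for s times a
  member of the family the constant term of r is s^2, so the unknown rescaling is read off the
  traces and cannot hide a parameter. The obstacle is to solve for q and r analytically in
  arbitrarily many parameters. Coprimality of \<lambda>^2 and \<lambda>^2 + 1 makes the linearized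
  factorization invertible, and the remaining terms are quadratic, so a single contraction argument
  suffices; all other operations are arithmetic and binomial series. In the lower bound the
  competing deformation is arbitrary, so the argument looks only at the parameter map, through its
  injectivity and continuity.\<close>

definition polybox :: "nat \<Rightarrow> (nat \<Rightarrow> real) \<Rightarrow> real \<Rightarrow> (nat \<Rightarrow> real) set" where
  "polybox k a r = {x \<in> topspace (Euclidean_space k). \<forall>i<k. \<bar>x i - a i\<bar> \<le> r}"

definition expands ::
  "nat \<Rightarrow> (nat \<Rightarrow> real) \<Rightarrow> real \<Rightarrow> ((nat \<Rightarrow> nat) \<Rightarrow> real) \<Rightarrow> ((nat \<Rightarrow> real) \<Rightarrow> real) \<Rightarrow> bool" where
  "expands k a r c f \<longleftrightarrow>
    (\<lambda>m. \<bar>c m\<bar> * r ^ (\<Sum>i<k. m i)) summable_on multi_indices k \<and>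
    (\<forall>x\<in>polybox k a r. ((\<lambda>m. (\<Prod>i<k. (x i - a i) ^ m i) * c m) has_sum f x) (multi_indices k))"

definition wnorm :: "nat \<Rightarrow> real \<Rightarrow> ((nat \<Rightarrow> nat) \<Rightarrow> real) \<Rightarrow> real" where
  "wnorm k r c = (\<Sum>\<^sub>\<infinity>m\<in>multi_indices k. \<bar>c m\<bar> * r ^ (\<Sum>i<k. m i))"

text \<open>The quantifier hides the coefficients, so that later estimates combine only functions
  and bounds.\<close>

definition bounded_expansion ::
  "nat \<Rightarrow> (nat \<Rightarrow> real) \<Rightarrow> real \<Rightarrow> real \<Rightarrow> ((nat \<Rightarrow> real) \<Rightarrow> real) \<Rightarrow> bool" where
  "bounded_expansion k a r N f \<longleftrightarrow> (\<exists>c. expands k a r c f \<and> wnorm k r c \<le> N)"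

lemma abs_monomial_le:
  assumes "x \<in> polybox k a r"
  shows "\<bar>\<Prod>i<k. (x i - a i) ^ m i\<bar> \<le> r ^ (\<Sum>i<k. m i)"
  using assms
  by (auto simp: abs_prod power_abs power_sum polybox_def intro!: prod_mono power_mono)

lemma zero_in_multi_indices [simp]: "(\<lambda>i. 0) \<in> multi_indices k"
  by (simp add: multi_indices_def)

lemma multi_indices_sum_eq_0_iff:
  "m \<in> multi_indices k \<Longrightarrow> (\<Sum>i<k. m i) = 0 \<longleftrightarrow> m = (\<lambda>i. 0)"
  by (auto simp: multi_indices_def fun_eq_iff) (metis lessThan_iff not_le)

lemma polybox_mono: "r \<le> r' \<Longrightarrow> polybox k a r \<subseteq> polybox k a r'"
  by (auto simp: polybox_def)

lemma wnorm_nonneg: "r \<ge> 0 \<Longrightarrow> wnorm k r c \<ge> 0"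
  unfolding wnorm_def by (rule infsum_nonneg) auto

lemma abs_le_bounded_expansion:
  assumes "bounded_expansion k a r N f" "x \<in> polybox k a r"
  shows "\<bar>f x\<bar> \<le> N"
proof -
  obtain c where c: "expands k a r c f" "wnorm k r c \<le> N"
    using assms(1) by (auto simp: bounded_expansion_def)
  let ?t = "\<lambda>m. (\<Prod>i<k. (x i - a i) ^ m i) * c m" and ?w = "\<lambda>m. \<bar>c m\<bar> * r ^ (\<Sum>i<k. m i)"
  have w: "?w summable_on multi_indices k" and t: "(?t has_sum f x) (multi_indices k)"
    using c assms(2) by (auto simp: expands_def)
  have le: "\<bar>?t m\<bar> \<le> ?w m" for m
    using abs_monomial_le[OF assms(2), of m] by (simp add: abs_mult mult.commute mult_left_mono)
  have "\<bar>f x\<bar> \<le> (\<Sum>\<^sub>\<infinity>m\<in>multi_indices k. \<bar>?t m\<bar>)"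
    using norm_infsum_bound[of ?t "multi_indices k"] infsumI[OF t] has_sum_imp_summable[OF t]
      summable_on_iff_abs_summable_on_real[of ?t "multi_indices k"] by simp
  also have "\<dots> \<le> wnorm k r c"
    unfolding wnorm_def using has_sum_imp_summable[OF t] w le
    by (intro infsum_mono) (auto simp: summable_on_iff_abs_summable_on_real[of ?t])
  finally have "\<bar>f x\<bar> \<le> wnorm k r c" .
  then show ?thesis using c by simp
qed

section \<open>Cauchy products of series over multi-indices\<close>

lemma finite_le_multi_index: "p \<in> multi_indices k \<Longrightarrow> finite {m. m \<le> p}"
proof -
  assume p: "p \<in> multi_indices k"
  have "finite {m. \<forall>i. (i \<in> {..<k} \<longrightarrow> m i \<in> {..(\<Sum>i<k. p i)}) \<and> (i \<notin> {..<k} \<longrightarrow> m i = 0)}"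
    by (rule finite_set_of_finite_funs) auto
  moreover have "{m. m \<le> p} \<subseteq>
      {m. \<forall>i. (i \<in> {..<k} \<longrightarrow> m i \<in> {..(\<Sum>i<k. p i)}) \<and> (i \<notin> {..<k} \<longrightarrow> m i = 0)}"
  proof (clarsimp simp: le_fun_def)
    fix m i assume m: "\<forall>x. m x \<le> p x"
    have "p i \<le> (\<Sum>i<k. p i)" if "i < k"
      by (rule member_le_sum) (use that in auto)
    then show "(i < k \<longrightarrow> m i \<le> sum p {..<k}) \<and> (\<not> i < k \<longrightarrow> m i = 0)"
      using m p by (auto simp: multi_indices_def intro: order_trans) (metis le_zero_eq not_le)
  qed
  ultimately show ?thesis by (rule rev_finite_subset)
qed

text \<open>Unordered summability of reals is absolute, so the double series converges on the
  product set and may be regrouped by the sum p of the two multi-indices; each group is finite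
  because p has finite support.\<close>

lemma has_sum_Cauchy_product:
  fixes F G :: "(nat \<Rightarrow> nat) \<Rightarrow> real"
  assumes F: "(F has_sum A) (multi_indices k)" and G: "(G has_sum B) (multi_indices k)"
  shows "((\<lambda>p. \<Sum>m\<in>{m. m \<le> p}. F m * G (\<lambda>i. p i - m i)) has_sum A * B) (multi_indices k)"
proof -
  let ?M = "multi_indices k"
  have aF: "(\<lambda>m. \<bar>F m\<bar>) summable_on ?M" and aG: "(\<lambda>m. \<bar>G m\<bar>) summable_on ?M"
    using F G summable_on_iff_abs_summable_on_real[of F ?M] summable_on_iff_abs_summable_on_real[of G ?M]
    by (auto simp: summable_on_def)
  have "(\<lambda>z. \<bar>F (fst z)\<bar> * \<bar>G (snd z)\<bar>) summable_on (?M \<times> ?M)"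
    by (rule summable_on_SigmaI[where g = "\<lambda>m. \<bar>F m\<bar> * (\<Sum>\<^sub>\<infinity>n\<in>?M. \<bar>G n\<bar>)"])
      (use aF aG in \<open>auto intro!: has_sum_cmult_right has_sum_infsum summable_on_cmult_left\<close>)
  then have "(\<lambda>z. F (fst z) * G (snd z)) summable_on (?M \<times> ?M)"
    by (subst summable_on_iff_abs_summable_on_real) (simp add: abs_mult)
  then have prod: "((\<lambda>z. F (fst z) * G (snd z)) has_sum A * B) (?M \<times> ?M)"
    by (rule has_sum_SigmaI[where g = "\<lambda>m. F m * B", rotated 2])
      (use F G in \<open>auto intro!: has_sum_cmult_right has_sum_cmult_left\<close>)
  \<comment> \<open>The inverse sends (m, n) to (m + n, m); truncated subtraction is exact because m
    \<le> p pointwise.\<close>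
  have bij: "bij_betw (\<lambda>(p, m). (m, (\<lambda>i. p i - m i))) (Sigma ?M (\<lambda>p. {m. m \<le> p})) (?M \<times> ?M)"
    by (rule bij_betw_byWitness[where f' = "\<lambda>(m, n). ((\<lambda>i. m i + n i), m)"])
      (auto simp: multi_indices_def le_fun_def fun_eq_iff, metis le_zero_eq)
  have "((\<lambda>(p, m). F m * G (\<lambda>i. p i - m i)) has_sum A * B) (Sigma ?M (\<lambda>p. {m. m \<le> p}))"
    using has_sum_reindex_bij_betw[OF bij, of "\<lambda>z. F (fst z) * G (snd z)"] prod
    by (simp add: case_prod_unfold)
  then show ?thesis
    by (rule has_sum_SigmaD) (auto intro: has_sum_finiteI finite_le_multi_index)
qed

definition coeff_mult :: "((nat \<Rightarrow> nat) \<Rightarrow> real) \<Rightarrow> ((nat \<Rightarrow> nat) \<Rightarrow> real) \<Rightarrow> (nat \<Rightarrow> nat) \<Rightarrow> real" where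
  "coeff_mult c d p = (\<Sum>m\<in>{m. m \<le> p}. c m * d (\<lambda>i. p i - m i))"

text \<open>The Cauchy product is applied twice: to the weighted absolute values, which bounds the
  norm, and to the terms themselves, which gives the value.\<close>

lemma expands_mult:
  assumes f: "expands k a r c f" and g: "expands k a r d g" and r: "r \<ge> 0"
  shows "expands k a r (coeff_mult c d) (\<lambda>x. f x * g x)"
    and "wnorm k r (coeff_mult c d) \<le> wnorm k r c * wnorm k r d"
proof -
  let ?M = "multi_indices k"
  let ?w = "\<lambda>c m. \<bar>c m\<bar> * r ^ (\<Sum>i<k. m i)"
  \<comment> \<open>One identity serves both applications: y is constantly r for the weights and x -
    a for the terms.\<close>
  have pw: "(\<Prod>i<k. y i ^ m i) * c m * ((\<Prod>i<k. y i ^ (p i - m i)) * d n)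
      = (\<Prod>i<k. y i ^ p i) * (c m * d n)" if "m \<le> p" for c d m n p and y :: "nat \<Rightarrow> real"
  proof -
    have "y i ^ p i = y i ^ m i * y i ^ (p i - m i)" for i
      using that by (simp add: le_fun_def power_add[symmetric])
    then show ?thesis by (simp add: prod.distrib algebra_simps)
  qed
  have pr: "(\<Prod>i<k. r ^ m i) = r ^ (\<Sum>i<k. m i)" for m
    by (simp add: power_sum)
  have S: "((\<lambda>p. \<Sum>m\<in>{m. m \<le> p}. ?w c m * ?w d (\<lambda>i. p i - m i)) has_sum wnorm k r c * wnorm k r d) ?M"
    by (rule has_sum_Cauchy_product)
      (use f g in \<open>auto simp: wnorm_def expands_def\<close>)
  have eq: "(\<Sum>m\<in>{m. m \<le> p}. ?w c m * ?w d (\<lambda>i. p i - m i))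
      = (\<Sum>m\<in>{m. m \<le> p}. \<bar>c m * d (\<lambda>i. p i - m i)\<bar>) * r ^ (\<Sum>i<k. p i)" for p
    unfolding sum_distrib_right
  proof (rule sum.cong)
    fix m assume "m \<in> {m. m \<le> p}"
    then show "?w c m * ?w d (\<lambda>i. p i - m i) = \<bar>c m * d (\<lambda>i. p i - m i)\<bar> * r ^ (\<Sum>i<k. p i)"
      using pw[of m p "\<lambda>_. r" "\<lambda>m. \<bar>c m\<bar>" "\<lambda>m. \<bar>d m\<bar>" "\<lambda>i. p i - m i"]
      by (simp add: pr abs_mult mult_ac)
  qed simp
  have le: "?w (coeff_mult c d) p \<le> (\<Sum>m\<in>{m. m \<le> p}. ?w c m * ?w d (\<lambda>i. p i - m i))" for p
    unfolding eq coeff_mult_def by (intro mult_right_mono sum_abs) (use r in auto)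
  have sm: "?w (coeff_mult c d) summable_on ?M"
    by (rule summable_on_comparison_test[OF has_sum_imp_summable[OF S] le]) (use r in auto)
  show "wnorm k r (coeff_mult c d) \<le> wnorm k r c * wnorm k r d"
    unfolding wnorm_def[of _ _ "coeff_mult c d"]
    by (rule has_sum_mono[OF has_sum_infsum[OF sm] S le])
  have "((\<lambda>p. (\<Prod>i<k. (x i - a i) ^ p i) * coeff_mult c d p) has_sum f x * g x) ?M"
    if x: "x \<in> polybox k a r" for x
  proof -
    have "((\<lambda>p. \<Sum>m\<in>{m. m \<le> p}. ((\<Prod>i<k. (x i - a i) ^ m i) * c m) *
        ((\<Prod>i<k. (x i - a i) ^ (p i - m i)) * d (\<lambda>i. p i - m i))) has_sum f x * g x) ?M"
      by (rule has_sum_Cauchy_product) (use f g x in \<open>auto simp: expands_def\<close>)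
    also have "(\<lambda>p. \<Sum>m\<in>{m. m \<le> p}. ((\<Prod>i<k. (x i - a i) ^ m i) * c m) *
        ((\<Prod>i<k. (x i - a i) ^ (p i - m i)) * d (\<lambda>i. p i - m i)))
        = (\<lambda>p. (\<Prod>i<k. (x i - a i) ^ p i) * coeff_mult c d p)"
      unfolding coeff_mult_def sum_distrib_left by (intro ext sum.cong refl pw) simp
    finally show ?thesis .
  qed
  with sm show "expands k a r (coeff_mult c d) (\<lambda>x. f x * g x)"
    by (simp add: expands_def)
qed

lemma bounded_expansion_mult:
  assumes f: "bounded_expansion k a r M f" and g: "bounded_expansion k a r N g" and r: "r \<ge> 0"
  shows "bounded_expansion k a r (M * N) (\<lambda>x. f x * g x)"
proof -
  obtain c d where c: "expands k a r c f" "wnorm k r c \<le> M"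
    and d: "expands k a r d g" "wnorm k r d \<le> N"
    using f g by (auto simp: bounded_expansion_def)
  have "wnorm k r c * wnorm k r d \<le> M * N"
    by (intro mult_mono c d wnorm_nonneg r order_trans[OF wnorm_nonneg[OF r] c(2)])
  with expands_mult[OF c(1) d(1) r] show ?thesis
    unfolding bounded_expansion_def by (meson order_trans)
qed

text \<open>This is the Weierstrass test in the weighted norm: summable bounds make the family
  indexed by j and m absolutely summable, and exchanging the sums yields coefficients of the limit.
  Finite sums, recentering, composition and the limit of the iteration all rest on it.\<close>

lemma bounded_expansion_has_sum:
  assumes f: "\<And>j. j \<in> I \<Longrightarrow> bounded_expansion k a r (N j) (f j)"
    and N: "N summable_on I" "infsum N I \<le> B"
    and g: "\<And>x. x \<in> polybox k a r \<Longrightarrow> ((\<lambda>j. f j x) has_sum g x) I"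
    and r: "r > 0"
  shows "bounded_expansion k a r B g"
proof -
  let ?M = "multi_indices k"
  from f have "\<forall>j. \<exists>c. j \<in> I \<longrightarrow> expands k a r c (f j) \<and> wnorm k r c \<le> N j"
    by (auto simp: bounded_expansion_def)
  then obtain c where c: "\<And>j. j \<in> I \<Longrightarrow> expands k a r (c j) (f j)"
      "\<And>j. j \<in> I \<Longrightarrow> wnorm k r (c j) \<le> N j"
    by metis
  let ?e = "\<lambda>j m. \<bar>c j m\<bar> * r ^ (\<Sum>i<k. m i)"
  have sj: "(?e j has_sum wnorm k r (c j)) ?M" if "j \<in> I" for j
    using c(1)[OF that] by (simp add: expands_def wnorm_def)
  have sN: "(\<lambda>j. wnorm k r (c j)) summable_on I"
    by (rule summable_on_comparison_test[OF N(1) c(2)]) (use r in \<open>auto intro: wnorm_nonneg\<close>)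
  have e: "(\<lambda>(j, m). ?e j m) summable_on (I \<times> ?M)"
    by (rule summable_on_SigmaI[where g = "\<lambda>j. wnorm k r (c j)"]) (use sj sN r in auto)
  then obtain E where E: "((\<lambda>(j, m). ?e j m) has_sum E) (I \<times> ?M)"
    by (auto simp: summable_on_def)
  have "((\<lambda>j. wnorm k r (c j)) has_sum E) I"
    by (rule has_sum_SigmaD[OF E]) (simp add: sj)
  then have EB: "E \<le> B"
    using infsum_mono[OF sN N(1) c(2)] N(2) infsumI by fastforce
  have E': "((\<lambda>(m, j). ?e j m) has_sum E) (?M \<times> I)"
    using E by (subst has_sum_swap) (simp add: case_prod_unfold)
  have es: "(\<lambda>j. ?e j m) summable_on I" if "m \<in> ?M" for m
    by (rule summable_on_SigmaD1[OF has_sum_imp_summable[OF E'] that])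
  \<comment> \<open>The weight is nonzero because r > 0, so it can be cancelled.\<close>
  have ac: "(\<lambda>j. \<bar>c j m\<bar>) summable_on I" if "m \<in> ?M" for m
    using summable_on_cmult_left'[of "r ^ (\<Sum>i<k. m i)" "\<lambda>j. \<bar>c j m\<bar>" I] es[OF that] r by simp
  then have sc: "(\<lambda>j. c j m) summable_on I" if "m \<in> ?M" for m
    using that by (subst summable_on_iff_abs_summable_on_real) simp
  define d where "d m = (\<Sum>\<^sub>\<infinity>j\<in>I. c j m)" for m
  have dle: "\<bar>d m\<bar> * r ^ (\<Sum>i<k. m i) \<le> (\<Sum>\<^sub>\<infinity>j\<in>I. ?e j m)" if m: "m \<in> ?M" for m
  proof -
    have "\<bar>d m\<bar> \<le> (\<Sum>\<^sub>\<infinity>j\<in>I. \<bar>c j m\<bar>)"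
      unfolding d_def using norm_infsum_bound[of "\<lambda>j. c j m" I] ac[OF m] by simp
    then show ?thesis
      using r by (simp add: infsum_cmult_left' mult_right_mono)
  qed
  have sE: "((\<lambda>m. \<Sum>\<^sub>\<infinity>j\<in>I. ?e j m) has_sum E) ?M"
    by (rule has_sum_SigmaD[OF E']) (simp add: es)
  have sd: "(\<lambda>m. \<bar>d m\<bar> * r ^ (\<Sum>i<k. m i)) summable_on ?M"
    by (rule summable_on_comparison_test[OF has_sum_imp_summable[OF sE] dle]) (use r in auto)
  have "wnorm k r d \<le> E"
    unfolding wnorm_def by (rule has_sum_mono[OF has_sum_infsum[OF sd] sE dle])
  moreover have "((\<lambda>m. (\<Prod>i<k. (x i - a i) ^ m i) * d m) has_sum g x) ?M"
    if x: "x \<in> polybox k a r" for x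
  proof -
    let ?t = "\<lambda>j m. (\<Prod>i<k. (x i - a i) ^ m i) * c j m"
    have "(\<lambda>(j, m). \<bar>?t j m\<bar>) summable_on (I \<times> ?M)"
      using abs_monomial_le[OF x]
      by (intro summable_on_comparison_test[OF e]) (auto simp: abs_mult mult.commute intro!: mult_left_mono)
    then have "(\<lambda>(j, m). ?t j m) summable_on (I \<times> ?M)"
      by (subst summable_on_iff_abs_summable_on_real) (simp add: case_prod_unfold)
    then obtain T where T: "((\<lambda>(j, m). ?t j m) has_sum T) (I \<times> ?M)"
      by (auto simp: summable_on_def)
    \<comment> \<open>The double sum is evaluated in both orders: over m first it is g x, over j
      first it is the series with coefficients \<open>d\<close>.\<close>
    have "((\<lambda>j. f j x) has_sum T) I"
      by (rule has_sum_SigmaD[OF T]) (use c x in \<open>auto simp: expands_def\<close>)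
    then have Tg: "T = g x"
      using g[OF x] has_sum_unique by blast
    have T': "((\<lambda>(m, j). ?t j m) has_sum T) (?M \<times> I)"
      using T by (subst has_sum_swap) (simp add: case_prod_unfold)
    show ?thesis
      unfolding Tg[symmetric] d_def
      by (rule has_sum_SigmaD[OF T']) (auto intro!: has_sum_cmult_right has_sum_infsum sc)
  qed
  ultimately show ?thesis
    using sd EB unfolding bounded_expansion_def expands_def by (intro exI[of _ d]) auto
qed

section \<open>Arithmetic of bounded expansions\<close>

lemma bounded_expansion_mono:
  "bounded_expansion k a r M f \<Longrightarrow> M \<le> N \<Longrightarrow> bounded_expansion k a r N f"
  unfolding bounded_expansion_def by (meson order_trans)

lemma bounded_expansion_cong:
  "(\<And>x. x \<in> polybox k a r \<Longrightarrow> f x = g x) \<Longrightarrow>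
    bounded_expansion k a r N f \<longleftrightarrow> bounded_expansion k a r N g"
  by (simp add: bounded_expansion_def expands_def)

lemma expands_subset:
  assumes c: "expands k a r c f" and r': "0 \<le> r'" "r' \<le> r"
  shows "expands k a r' c f" "wnorm k r' c \<le> wnorm k r c"
proof -
  let ?w = "\<lambda>r m. \<bar>c m\<bar> * r ^ (\<Sum>i<k. m i)"
  have le: "?w r' m \<le> ?w r m" for m
    using r' by (intro mult_left_mono power_mono) auto
  have s: "?w r summable_on multi_indices k"
    using c by (simp add: expands_def)
  have s': "?w r' summable_on multi_indices k"
    by (rule summable_on_comparison_test[OF s le]) (use r' in auto)
  show "expands k a r' c f"
    using c s' polybox_mono[OF r'(2)] by (auto simp: expands_def)
  show "wnorm k r' c \<le> wnorm k r c"
    unfolding wnorm_def by (rule infsum_mono[OF s' s le])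
qed

lemma bounded_expansion_subset:
  "bounded_expansion k a r N f \<Longrightarrow> 0 \<le> r' \<Longrightarrow> r' \<le> r \<Longrightarrow> bounded_expansion k a r' N f"
  unfolding bounded_expansion_def by (meson expands_subset order_trans)

lemma bounded_expansion_const: "bounded_expansion k a r \<bar>b\<bar> (\<lambda>x. b)"
proof -
  let ?c = "\<lambda>m. if m = (\<lambda>i. 0::nat) then b else 0"
  have *: "((\<lambda>m. h m * g (?c m)) has_sum h (\<lambda>i. 0) * g b) (multi_indices k)"
    if "g 0 = 0" for h :: "(nat \<Rightarrow> nat) \<Rightarrow> real" and g :: "real \<Rightarrow> real"
    by (rule has_sum_finite_neutralI[where B = "{\<lambda>i. 0}"]) (use that in auto)
  show ?thesis
    unfolding bounded_expansion_def expands_def wnorm_def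
    using *[of abs "\<lambda>m. r ^ (\<Sum>i<k. m i)"] *[of "\<lambda>x. x" "\<lambda>m. \<Prod>i<k. (x i - a i) ^ m i" for x]
    by (intro exI[of _ ?c]) (auto simp: mult.commute[of "abs _"] summable_on_def infsumI)
qed

lemma bounded_expansion_shifted_coordinate:
  assumes j: "j < k"
  shows "bounded_expansion k a r r (\<lambda>x. x j - a j)"
proof -
  let ?e = "\<lambda>i. if i = j then 1 else 0 :: nat"
  let ?c = "\<lambda>m. if m = ?e then 1 else 0 :: real"
  have e: "?e \<in> multi_indices k"
    using j by (auto simp: multi_indices_def)
  have *: "((\<lambda>m. h m * ?c m) has_sum h ?e) (multi_indices k)"
    for h :: "(nat \<Rightarrow> nat) \<Rightarrow> real"
    by (rule has_sum_finite_neutralI[where B = "{?e}"]) (use e in auto)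
  have 1: "(\<Sum>i<k. ?e i) = 1"
    using j by simp
  have 2: "(\<Prod>i<k. y i ^ ?e i) = y j" for y :: "nat \<Rightarrow> real"
    using j by (simp add: if_distrib cong: if_cong)
  have 3: "\<bar>?c m\<bar> = ?c m" for m by simp
  show ?thesis
    unfolding bounded_expansion_def expands_def wnorm_def
    using *[of "\<lambda>m. r ^ (\<Sum>i<k. m i)"] *[of "\<lambda>m. \<Prod>i<k. (x i - a i) ^ m i" for x]
    unfolding 1 2
    by (intro exI[of _ ?c], unfold 3) (auto simp: mult.commute[of "?c _"] summable_on_def infsumI)
qed

lemma bounded_expansion_sum:
  assumes "finite I" "r > 0" "\<And>j. j \<in> I \<Longrightarrow> bounded_expansion k a r (N j) (f j)"
  shows "bounded_expansion k a r (\<Sum>j\<in>I. N j) (\<lambda>x. \<Sum>j\<in>I. f j x)"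
  by (rule bounded_expansion_has_sum[where I = I and f = f and N = N]) (use assms in auto)

lemma bounded_expansion_add:
  assumes "r > 0" "bounded_expansion k a r M f" "bounded_expansion k a r N g"
  shows "bounded_expansion k a r (M + N) (\<lambda>x. f x + g x)"
  using bounded_expansion_sum[of UNIV r k a "\<lambda>b. if b then M else N" "\<lambda>b. if b then f else g"] assms
  by (simp add: UNIV_bool add.commute)

lemma bounded_expansion_cmult:
  assumes "r \<ge> 0" "bounded_expansion k a r N f"
  shows "bounded_expansion k a r (\<bar>b\<bar> * N) (\<lambda>x. b * f x)"
  using bounded_expansion_mult[OF bounded_expansion_const assms(2,1)] .

lemma bounded_expansion_diff:
  assumes "r > 0" "bounded_expansion k a r M f" "bounded_expansion k a r N g"
  shows "bounded_expansion k a r (M + N) (\<lambda>x. f x - g x)"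
  using bounded_expansion_add[OF assms(1,2) bounded_expansion_cmult[OF _ assms(3), of "-1"]] assms(1)
  by simp

lemma bounded_expansion_coordinate:
  assumes "j < k" "r > 0"
  shows "bounded_expansion k a r (\<bar>a j\<bar> + r) (\<lambda>x. x j)"
  using bounded_expansion_add[OF assms(2) bounded_expansion_const[of k a r "a j"]
      bounded_expansion_shifted_coordinate[OF assms(1), of a r]] by simp

lemma bounded_expansion_power:
  assumes "r \<ge> 0" "bounded_expansion k a r N f"
  shows "bounded_expansion k a r (N ^ n) (\<lambda>x. f x ^ n)"
proof (induction n)
  case 0
  then show ?case using bounded_expansion_const[of k a r 1] by simp
next
  case (Suc n)
  then show ?case using bounded_expansion_mult[OF assms(2) Suc assms(1)] by simp
qed

lemma bounded_expansion_prod: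
  assumes "finite I" "r \<ge> 0" "\<And>j. j \<in> I \<Longrightarrow> bounded_expansion k a r (N j) (f j)"
  shows "bounded_expansion k a r (\<Prod>j\<in>I. N j) (\<lambda>x. \<Prod>j\<in>I. f j x)"
  using assms
proof (induction I rule: finite_induct)
  case empty
  then show ?case using bounded_expansion_const[of k a r 1] by simp
qed (simp add: bounded_expansion_mult)

section \<open>Constant terms, change of radius and centre, composition\<close>

lemma expands_coeff_0:
  assumes c: "expands k a r c f" and r: "r \<ge> 0" and a: "a \<in> topspace (Euclidean_space k)"
  shows "c (\<lambda>i. 0) = f a"
proof -
  have "((\<lambda>m. (\<Prod>i<k. (a i - a i) ^ m i) * c m) has_sum f a) (multi_indices k)"
  proof -
    have "a \<in> polybox k a r" using r a by (simp add: polybox_def)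
    then show ?thesis using c unfolding expands_def by blast
  qed
  moreover have "((\<lambda>m. (\<Prod>i<k. (a i - a i) ^ m i) * c m) has_sum c (\<lambda>i. 0)) (multi_indices k)"
  proof (rule has_sum_finite_neutralI[where B = "{\<lambda>i. 0}"])
    fix m assume m: "m \<in> multi_indices k - {\<lambda>i. 0}"
    then have "\<exists>i<k. m i \<noteq> 0"
      by (auto simp: multi_indices_def fun_eq_iff) (metis less_irrefl not_le)
    then show "(\<Prod>i<k. (a i - a i) ^ m i) * c m = 0"
      by (auto simp: power_0_left)
  qed auto
  ultimately show ?thesis by (rule has_sum_unique[symmetric])
qed

text \<open>Without a constant term every monomial has degree at least 1, so passing to radius t * r
  with t \<le> 1 multiplies the norm by at most t. This is the source of all smallness near the
  origin.\<close>

lemma bounded_expansion_shrink: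
  assumes f: "bounded_expansion k a r N f" and r: "r > 0" and a: "a \<in> topspace (Euclidean_space k)"
    and fa: "f a = 0" and \<epsilon>: "\<epsilon> > 0"
  obtains r' where "0 < r'" "r' \<le> r" "bounded_expansion k a r' \<epsilon> f"
proof -
  obtain c where c: "expands k a r c f" "wnorm k r c \<le> N"
    using f by (auto simp: bounded_expansion_def)
  have c0: "c (\<lambda>i. 0) = 0"
    using expands_coeff_0[OF c(1) _ a] r fa by simp
  \<comment> \<open>The maximum with 1 keeps the divisor, and with it t, positive.\<close>
  define N' where "N' = max N 1"
  define t where "t = min 1 (\<epsilon> / N')"
  have N': "N' \<ge> 1" "wnorm k r c \<le> N'" using c(2) by (auto simp: N'_def)
  have t: "0 < t" "t \<le> 1" "t * N' \<le> \<epsilon>"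
    using \<epsilon> N' by (auto simp: t_def min_def field_simps)
  let ?w = "\<lambda>r m. \<bar>c m\<bar> * r ^ (\<Sum>i<k. m i)"
  have r': "0 < t * r" "t * r \<le> r"
    using t r by (auto simp: mult_le_cancel_right1)
  have le: "?w (t * r) m \<le> t * ?w r m" if m: "m \<in> multi_indices k" for m
  proof (cases "m = (\<lambda>i. 0)")
    case False
    then have "1 \<le> (\<Sum>i<k. m i)"
      using multi_indices_sum_eq_0_iff[OF m] by linarith
    then have "t ^ (\<Sum>i<k. m i) \<le> t ^ 1"
      using t by (intro power_decreasing) auto
    then show ?thesis
      using r mult_left_mono[of "t ^ (\<Sum>i<k. m i)" t "?w r m"]
      by (simp add: power_mult_distrib mult_ac)
  qed (simp add: c0)
  have s: "?w r summable_on multi_indices k"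
    using c by (simp add: expands_def)
  have c': "expands k a (t * r) c f"
    using expands_subset[OF c(1)] r' by simp
  then have s': "?w (t * r) summable_on multi_indices k"
    by (simp add: expands_def)
  have "wnorm k (t * r) c \<le> (\<Sum>\<^sub>\<infinity>m\<in>multi_indices k. t * ?w r m)"
    unfolding wnorm_def by (rule infsum_mono[OF s' summable_on_cmult_right[OF s] le])
  also have "\<dots> = t * wnorm k r c"
    unfolding wnorm_def by (rule infsum_cmult_right[OF s])
  also have "\<dots> \<le> \<epsilon>"
    using t N' by (smt (verit) mult_left_mono)
  finally show ?thesis
    using that[OF r'] c' by (auto simp: bounded_expansion_def)
qed

text \<open>Since x j = a j + (x j - a j), the coordinate has norm at most \<tau> + \<sigma> about
  a. Each monomial therefore keeps the weight it had at the origin, and the series is reassembled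
  about a with the same bound.\<close>

lemma bounded_expansion_recenter:
  assumes f: "bounded_expansion k origin (\<sigma> + \<tau>) N f" and \<sigma>: "\<sigma> > 0" and \<tau>: "\<tau> \<ge> 0"
    and a: "a \<in> polybox k origin \<tau>"
  shows "bounded_expansion k a \<sigma> N f"
proof -
  let ?r = "\<sigma> + \<tau>"
  obtain c where c: "expands k origin ?r c f" "wnorm k ?r c \<le> N"
    using f by (auto simp: bounded_expansion_def)
  have sub: "polybox k a \<sigma> \<subseteq> polybox k origin ?r"
    using a by (fastforce simp: polybox_def origin_def)
  show ?thesis
  proof (rule bounded_expansion_has_sum[where I = "multi_indices k"
        and f = "\<lambda>m x. c m * (\<Prod>i<k. x i ^ m i)" and N = "\<lambda>m. \<bar>c m\<bar> * ?r ^ (\<Sum>i<k. m i)"])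
    fix m
    have "bounded_expansion k a \<sigma> ?r (\<lambda>x. x j)" if "j < k" for j
      by (rule bounded_expansion_mono[OF bounded_expansion_coordinate[OF that \<sigma>]])
        (use a that in \<open>auto simp: polybox_def origin_def\<close>)
    then have "bounded_expansion k a \<sigma> (\<Prod>i<k. ?r ^ m i) (\<lambda>x. \<Prod>i<k. x i ^ m i)"
      using \<sigma> by (intro bounded_expansion_prod bounded_expansion_power) auto
    then show "bounded_expansion k a \<sigma> (\<bar>c m\<bar> * ?r ^ (\<Sum>i<k. m i)) (\<lambda>x. c m * (\<Prod>i<k. x i ^ m i))"
      using bounded_expansion_cmult[of \<sigma>] \<sigma> by (simp add: power_sum)
  qed (use c sub \<sigma> in \<open>auto simp: expands_def wnorm_def origin_def mult.commute\<close>)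
qed

text \<open>The term \<open>b n * f x ^ n\<close> has norm at most
  \<open>\<bar>b n\<bar> * N ^ n\<close>, and these bounds are summable.\<close>

lemma bounded_expansion_power_series:
  assumes f: "bounded_expansion k a r N f" and r: "r > 0"
    and g: "\<And>y. \<bar>y\<bar> \<le> N \<Longrightarrow> (\<lambda>n. b n * y ^ n) sums g y"
    and N: "summable (\<lambda>n. \<bar>b n\<bar> * N ^ n)" "N \<ge> 0"
  shows "bounded_expansion k a r (suminf (\<lambda>n. \<bar>b n\<bar> * N ^ n)) (\<lambda>x. g (f x))"
proof (rule bounded_expansion_has_sum[where I = UNIV and f = "\<lambda>n x. b n * f x ^ n" and N = "\<lambda>n. \<bar>b n\<bar> * N ^ n"])
  show "bounded_expansion k a r (\<bar>b n\<bar> * N ^ n) (\<lambda>x. b n * f x ^ n)" for n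
    using f r by (intro bounded_expansion_cmult bounded_expansion_power) auto
  have "((\<lambda>n. \<bar>b n\<bar> * N ^ n) has_sum suminf (\<lambda>n. \<bar>b n\<bar> * N ^ n)) UNIV"
    using N by (intro sums_nonneg_imp_has_sum) auto
  then show "(\<lambda>n. \<bar>b n\<bar> * N ^ n) summable_on UNIV" "(\<Sum>\<^sub>\<infinity>n. \<bar>b n\<bar> * N ^ n) \<le> suminf (\<lambda>n. \<bar>b n\<bar> * N ^ n)"
    by (auto simp: summable_on_def infsumI)
  show "((\<lambda>n. b n * f x ^ n) has_sum g (f x)) UNIV" if x: "x \<in> polybox k a r" for x
  proof (rule norm_summable_imp_has_sum)
    have fx: "\<bar>f x\<bar> \<le> N" by (rule abs_le_bounded_expansion[OF f x])
    show "summable (\<lambda>n. norm (b n * f x ^ n))"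
      by (rule summable_comparison_test'[OF N(1)]) (use fx in \<open>auto simp: abs_mult power_abs intro!: mult_left_mono power_mono\<close>)
    show "(\<lambda>n. b n * f x ^ n) sums g (f x)"
      by (rule g[OF fx])
  qed
qed (use r in auto)

section \<open>Germs of real-analytic functions\<close>

text \<open>With this filter the existential neighbourhoods of the definitions become
  \<open>eventually\<close> statements, which can be combined without naming the open sets.\<close>

abbreviation nhds0 :: "nat \<Rightarrow> (nat \<Rightarrow> real) filter" where
  "nhds0 k \<equiv> nhdsin (Euclidean_space k) origin"

lemma origin_in_Euclidean_space [simp]: "origin \<in> topspace (Euclidean_space k)"
  by (simp add: topspace_Euclidean_space origin_def)

lemma eventually_nhds0:
  "eventually P (nhds0 k) \<longleftrightarrow> (\<exists>U. openin (Euclidean_space k) U \<and> origin \<in> U \<and> (\<forall>x\<in>U. P x))"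
  by (simp add: eventually_nhdsin)

lemma openin_open_polybox:
  "openin (Euclidean_space k) {x \<in> topspace (Euclidean_space k). \<forall>i<k. \<bar>x i - a i\<bar> < r}"
proof -
  have 1: "openin (Euclidean_space k) {x \<in> topspace (Euclidean_space k). x i \<in> {a i - r<..<a i + r}}" for i
    by (rule openin_continuous_map_preimage[where Y = euclideanreal])
      (auto simp: Euclidean_space_def intro!: continuous_map_from_subtopology continuous_map_product_coordinates)
  have "openin (Euclidean_space k)
      (topspace (Euclidean_space k) \<inter> (\<Inter>i\<in>{..<k}. {x \<in> topspace (Euclidean_space k). x i \<in> {a i - r<..<a i + r}}))"
    using 1 by (cases "k = 0") (auto intro!: openin_Int openin_INT2)
  also have "(topspace (Euclidean_space k) \<inter> (\<Inter>i\<in>{..<k}. {x \<in> topspace (Euclidean_space k). x i \<in> {a i - r<..<a i + r}}))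
     = {x \<in> topspace (Euclidean_space k). \<forall>i<k. \<bar>x i - a i\<bar> < r}"
    by (auto simp: abs_less_iff algebra_simps)
  finally show ?thesis .
qed

lemma openin_contains_polybox:
  assumes U: "openin (Euclidean_space k) U" and a: "a \<in> U"
  obtains r where "r > 0" "polybox k a r \<subseteq> U"
proof -
  obtain T where T: "openin (powertop_real UNIV) T" "U = T \<inter> {x. \<forall>i\<ge>k. x i = 0}"
    using U by (auto simp: Euclidean_space_def openin_subtopology)
  then have "a \<in> T" using a by auto
  obtain X where X: "a \<in> (\<Pi>\<^sub>E i\<in>UNIV. X i)" "\<And>i. openin euclideanreal (X i)" "(\<Pi>\<^sub>E i\<in>UNIV. X i) \<subseteq> T"
    using product_topology_open_contains_basis[OF T(1) \<open>a \<in> T\<close>] by metis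
  have "\<exists>e>0. \<forall>y. \<bar>y - a i\<bar> \<le> e \<longrightarrow> y \<in> X i" for i
  proof -
    obtain e where "e > 0" "\<And>y. dist y (a i) < e \<Longrightarrow> y \<in> X i"
      using X(1) X(2)[of i] unfolding open_openin[symmetric] open_dist by (meson PiE_mem UNIV_I)
    then show ?thesis
      by (intro exI[of _ "e / 2"]) (auto simp: dist_real_def)
  qed
  then obtain e where e: "\<And>i. e i > 0" "\<And>i y. \<bar>y - a i\<bar> \<le> e i \<Longrightarrow> y \<in> X i"
    by metis
  \<comment> \<open>\<open>insert 1\<close> keeps the minimum meaningful when k = 0.\<close>
  define r where "r = Min (insert 1 (e ` {..<k}))"
  have r: "r > 0" "\<And>i. i < k \<Longrightarrow> r \<le> e i"
    using e(1) by (auto simp: r_def)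
  have "polybox k a r \<subseteq> U"
  proof
    fix x assume x: "x \<in> polybox k a r"
    have "x i \<in> X i" for i
    proof (cases "i < k")
      case True
      then show ?thesis using x r e by (force simp: polybox_def)
    next
      case False
      then have "x i = a i"
        using x T(2) a by (auto simp: polybox_def topspace_Euclidean_space)
      then show ?thesis using X(1) by auto
    qed
    then show "x \<in> U"
      using X(3) x T(2) by (auto simp: polybox_def topspace_Euclidean_space)
  qed
  with r(1) that show ?thesis by blast
qed

lemma eventually_polybox: "r > 0 \<Longrightarrow> eventually (\<lambda>x. x \<in> polybox k origin r) (nhds0 k)"
  unfolding eventually_nhds0 using openin_open_polybox[of k origin r]
  by (intro exI[of _ "{x \<in> topspace (Euclidean_space k). \<forall>i<k. \<bar>x i - origin i\<bar> < r}"])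
    (auto simp: polybox_def)

lemma eventually_nhds0_iff_polybox:
  "eventually P (nhds0 k) \<longleftrightarrow> (\<exists>r>0. \<forall>x\<in>polybox k origin r. P x)"
proof
  assume "eventually P (nhds0 k)"
  then show "\<exists>r>0. \<forall>x\<in>polybox k origin r. P x"
    unfolding eventually_nhds0 by (meson openin_contains_polybox subsetD)
next
  assume "\<exists>r>0. \<forall>x\<in>polybox k origin r. P x"
  then obtain r where "r > 0" "\<forall>x\<in>polybox k origin r. P x" by blast
  then show "eventually P (nhds0 k)"
    by (intro eventually_mono[OF eventually_polybox[of r k]]) auto
qed

text \<open>At the corner of a box every x i - a i equals r. Convergence there is unordered, hence
  absolute, and is exactly the weighted summability demanded by \<open>expands\<close>.\<close>

lemma has_power_series_at_imp_expands:
  fixes f :: "(nat \<Rightarrow> real) \<Rightarrow> real"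
  assumes "has_power_series_at k f a c"
  obtains r where "r > 0" "expands k a r c f"
proof -
  obtain U where U: "openin (Euclidean_space k) U" "a \<in> U"
    "\<And>x. x \<in> U \<Longrightarrow> ((\<lambda>m. (\<Prod>i<k. (x i - a i) ^ m i) * c m) has_sum f x) (multi_indices k)"
    using assms by (auto simp: has_power_series_at_def)
  obtain r where r: "r > 0" "polybox k a r \<subseteq> U"
    using openin_contains_polybox U by metis
  define y where "y i = (if i < k then a i + r else 0)" for i
  have "y \<in> polybox k a r"
    using r(1) by (simp add: y_def polybox_def topspace_Euclidean_space)
  then have "(\<lambda>m. (\<Prod>i<k. (y i - a i) ^ m i) * c m) summable_on multi_indices k"
    using U(3) r(2) by (auto simp: summable_on_def)
  moreover have "(\<Prod>i<k. (y i - a i) ^ m i) = r ^ (\<Sum>i<k. m i)" for m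
    by (simp add: y_def power_sum)
  ultimately have "(\<lambda>m. \<bar>c m\<bar> * r ^ (\<Sum>i<k. m i)) summable_on multi_indices k"
    using r(1) summable_on_iff_abs_summable_on_real[of "\<lambda>m. r ^ (\<Sum>i<k. m i) * c m" "multi_indices k"]
    by (simp add: abs_mult mult.commute)
  then show ?thesis
    using that[OF r(1)] U(3) r(2) by (auto simp: expands_def)
qed

lemma expands_imp_has_power_series_at:
  assumes "expands k a r c f" "r > 0" "a \<in> topspace (Euclidean_space k)"
  shows "has_power_series_at k f a c"
  unfolding has_power_series_at_def using openin_open_polybox[of k a r] assms
  by (intro exI[of _ "{x \<in> topspace (Euclidean_space k). \<forall>i<k. \<bar>x i - a i\<bar> < r}"])
    (auto simp: expands_def polybox_def less_imp_le)

text \<open>A germ asks for a power series at every nearby point, and one expansion at the origin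
  provides them all: half of its radius is spent on the displacement, half on the recentred
  series.\<close>

lemma real_analytic_germ_iff_bounded_expansion:
  fixes f :: "(nat \<Rightarrow> real) \<Rightarrow> real"
  shows "real_analytic_germ k f \<longleftrightarrow> (\<exists>r>0. \<exists>N. bounded_expansion k origin r N f)"
proof
  assume "real_analytic_germ k f"
  then obtain c where "has_power_series_at k f origin c"
    by (auto simp: real_analytic_germ_def)
  then show "\<exists>r>0. \<exists>N. bounded_expansion k origin r N f"
    by (metis has_power_series_at_imp_expands bounded_expansion_def order_refl)
next
  assume "\<exists>r>0. \<exists>N. bounded_expansion k origin r N f"
  then obtain r N where r: "r > 0" "bounded_expansion k origin (r / 2 + r / 2) N f"
    by auto
  let ?U = "{x \<in> topspace (Euclidean_space k). \<forall>i<k. \<bar>x i - origin i\<bar> < r / 2}"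
  have "\<exists>c. has_power_series_at k f a c" if a: "a \<in> ?U" for a
  proof -
    have "bounded_expansion k a (r / 2) N f"
      by (rule bounded_expansion_recenter[OF r(2)]) (use r a in \<open>auto simp: polybox_def\<close>)
    then show ?thesis
      using r(1) a expands_imp_has_power_series_at[of k a "r / 2" _ f]
      by (auto simp: bounded_expansion_def)
  qed
  then show "real_analytic_germ k f"
    unfolding real_analytic_germ_def using openin_open_polybox[of k origin "r / 2"] r(1)
    by (intro exI[of _ ?U]) auto
qed

lemma real_analytic_germI:
  "r > 0 \<Longrightarrow> bounded_expansion k origin r N f \<Longrightarrow> real_analytic_germ k f"
  by (auto simp: real_analytic_germ_iff_bounded_expansion)

lemma bounded_expansion_common_radius:
  assumes "finite I" "\<And>i. i \<in> I \<Longrightarrow> \<exists>r>0. bounded_expansion k a r (N i) (f i)"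
  obtains r where "r > 0" "\<And>i. i \<in> I \<Longrightarrow> bounded_expansion k a r (N i) (f i)"
proof -
  obtain \<rho> where \<rho>: "\<And>i. i \<in> I \<Longrightarrow> \<rho> i > 0 \<and> bounded_expansion k a (\<rho> i) (N i) (f i)"
    using assms(2) by metis
  define r where "r = Min (insert 1 (\<rho> ` I))"
  have "r > 0" "\<And>i. i \<in> I \<Longrightarrow> r \<le> \<rho> i"
    using assms(1) \<rho> by (auto simp: r_def)
  then show ?thesis
    using that \<rho> bounded_expansion_subset by (metis less_imp_le)
qed

lemma real_analytic_germ_pair:
  fixes f g :: "(nat \<Rightarrow> real) \<Rightarrow> real"
  assumes "real_analytic_germ k f" "real_analytic_germ k g"
  obtains r M N where "r > 0" "bounded_expansion k origin r M f" "bounded_expansion k origin r N g"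
proof -
  obtain M N where MN: "\<exists>r>0. bounded_expansion k origin r M f" "\<exists>r>0. bounded_expansion k origin r N g"
    using assms by (auto simp: real_analytic_germ_iff_bounded_expansion)
  obtain r where r: "r > 0"
    "\<And>b :: bool. bounded_expansion k origin r (if b then M else N) (if b then f else g)"
    by (rule bounded_expansion_common_radius[of UNIV k origin "\<lambda>b. if b then M else N" "\<lambda>b. if b then f else g"])
      (use MN in auto)
  then show ?thesis
    using that r(2)[of True] r(2)[of False] by auto
qed

section \<open>Germs under arithmetic, real powers and inverses\<close>

lemma real_analytic_germ_const: "real_analytic_germ k (\<lambda>x. b :: real)"
  by (rule real_analytic_germI[OF zero_less_one bounded_expansion_const])

lemma real_analytic_germ_coordinate: "i < k \<Longrightarrow> real_analytic_germ k (\<lambda>x. x i)"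
  by (rule real_analytic_germI[OF zero_less_one bounded_expansion_coordinate]) auto

lemma real_analytic_germ_add:
  fixes f g :: "(nat \<Rightarrow> real) \<Rightarrow> real"
  assumes "real_analytic_germ k f" "real_analytic_germ k g"
  shows "real_analytic_germ k (\<lambda>x. f x + g x)"
  by (rule real_analytic_germ_pair[OF assms])
    (blast intro: real_analytic_germI bounded_expansion_add)

lemma real_analytic_germ_mult:
  fixes f g :: "(nat \<Rightarrow> real) \<Rightarrow> real"
  assumes "real_analytic_germ k f" "real_analytic_germ k g"
  shows "real_analytic_germ k (\<lambda>x. f x * g x)"
  by (rule real_analytic_germ_pair[OF assms])
    (blast intro: real_analytic_germI bounded_expansion_mult less_imp_le)

lemma real_analytic_germ_uminus:
  fixes f :: "(nat \<Rightarrow> real) \<Rightarrow> real"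
  shows "real_analytic_germ k f \<Longrightarrow> real_analytic_germ k (\<lambda>x. - f x)"
  using real_analytic_germ_mult[OF real_analytic_germ_const[of k "-1"], of f] by simp

lemma real_analytic_germ_diff:
  fixes f g :: "(nat \<Rightarrow> real) \<Rightarrow> real"
  shows "real_analytic_germ k f \<Longrightarrow> real_analytic_germ k g \<Longrightarrow> real_analytic_germ k (\<lambda>x. f x - g x)"
  using real_analytic_germ_add[of k f, OF _ real_analytic_germ_uminus, of g] by simp

lemma real_analytic_germ_sum:
  fixes f :: "'i \<Rightarrow> (nat \<Rightarrow> real) \<Rightarrow> real"
  shows "(\<And>i. i \<in> I \<Longrightarrow> real_analytic_germ k (f i)) \<Longrightarrow> real_analytic_germ k (\<lambda>x. \<Sum>i\<in>I. f i x)"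
  by (induction I rule: infinite_finite_induct) (auto intro: real_analytic_germ_const real_analytic_germ_add)

lemma real_analytic_germ_prod:
  fixes f :: "'i \<Rightarrow> (nat \<Rightarrow> real) \<Rightarrow> real"
  shows "(\<And>i. i \<in> I \<Longrightarrow> real_analytic_germ k (f i)) \<Longrightarrow> real_analytic_germ k (\<lambda>x. \<Prod>i\<in>I. f i x)"
  by (induction I rule: infinite_finite_induct) (auto intro: real_analytic_germ_const real_analytic_germ_mult)

lemma real_analytic_germ_power:
  fixes f :: "(nat \<Rightarrow> real) \<Rightarrow> real"
  shows "real_analytic_germ k f \<Longrightarrow> real_analytic_germ k (\<lambda>x. f x ^ n)"
  by (induction n) (auto intro: real_analytic_germ_const real_analytic_germ_mult)

lemma real_analytic_germ_small:
  fixes f :: "(nat \<Rightarrow> real) \<Rightarrow> real"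
  assumes "real_analytic_germ k f" "f origin = 0" "\<epsilon> > 0"
  obtains r where "r > 0" "bounded_expansion k origin r \<epsilon> f"
proof -
  obtain r N where "r > 0" "bounded_expansion k origin r N f"
    using assms(1) by (auto simp: real_analytic_germ_iff_bounded_expansion)
  then show ?thesis
    using bounded_expansion_shrink[of k origin r N f \<epsilon>] assms(2,3) that by auto
qed

lemma real_analytic_germ_tendsto:
  fixes f :: "(nat \<Rightarrow> real) \<Rightarrow> real"
  assumes f: "real_analytic_germ k f"
  shows "(f \<longlongrightarrow> f origin) (nhds0 k)"
proof (rule tendstoI)
  fix e :: real assume e: "e > 0"
  have "real_analytic_germ k (\<lambda>x. f x - f origin)"
    by (intro real_analytic_germ_diff f real_analytic_germ_const)
  then obtain r where r: "r > 0" "bounded_expansion k origin r (e / 2) (\<lambda>x. f x - f origin)"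
    using real_analytic_germ_small e by (metis diff_self half_gt_zero)
  show "eventually (\<lambda>x. dist (f x) (f origin) < e) (nhds0 k)"
    using eventually_polybox[OF r(1)]
    by eventually_elim (use abs_le_bounded_expansion[OF r(2)] e in \<open>force simp: dist_real_def\<close>)
qed

lemma real_analytic_germ_cong:
  fixes f g :: "(nat \<Rightarrow> real) \<Rightarrow> real"
  assumes f: "real_analytic_germ k f" and eq: "eventually (\<lambda>x. f x = g x) (nhds0 k)"
  shows "real_analytic_germ k g"
proof -
  obtain r N where r: "r > 0" "bounded_expansion k origin r N f"
    using f by (auto simp: real_analytic_germ_iff_bounded_expansion)
  obtain \<rho> where \<rho>: "\<rho> > 0" "\<And>x. x \<in> polybox k origin \<rho> \<Longrightarrow> f x = g x"
    using eq by (auto simp: eventually_nhds0_iff_polybox)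
  have "bounded_expansion k origin (min r \<rho>) N f"
    using bounded_expansion_subset[OF r(2)] r(1) \<rho>(1) by simp
  then have "bounded_expansion k origin (min r \<rho>) N g"
    using \<rho>(2) polybox_mono[of "min r \<rho>" \<rho> k origin]
    by (subst (asm) bounded_expansion_cong[where g = g]) auto
  then show ?thesis
    using r(1) \<rho>(1) by (intro real_analytic_germI[of "min r \<rho>"]) auto
qed

lemma real_analytic_germ_powr:
  fixes f :: "(nat \<Rightarrow> real) \<Rightarrow> real"
  assumes f: "real_analytic_germ k f" and f1: "f origin = 1"
  shows "real_analytic_germ k (\<lambda>x. f x powr a)"
proof -
  have "real_analytic_germ k (\<lambda>x. f x - 1)"
    by (intro real_analytic_germ_diff f real_analytic_germ_const)
  then obtain r where r: "r > 0" "bounded_expansion k origin r (1/2) (\<lambda>x. f x - 1)"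
    by (rule real_analytic_germ_small[of _ _ "1/2"]) (use f1 in auto)
  \<comment> \<open>Convergence at 3/4 gives absolute convergence at 1/2, the bound arranged for f -
    1.\<close>
  have "summable (\<lambda>n. (a gchoose n) * (3/4) ^ n)"
    using gen_binomial_real[of "3/4" a] by (auto simp: sums_iff)
  then have "summable (\<lambda>n. norm ((a gchoose n) * (1/2) ^ n))"
    by (rule powser_insidea) simp
  then have s: "summable (\<lambda>n. \<bar>a gchoose n\<bar> * (1/2) ^ n)"
    by (simp add: abs_mult)
  have "bounded_expansion k origin r (suminf (\<lambda>n. \<bar>a gchoose n\<bar> * (1/2) ^ n)) (\<lambda>x. (1 + (f x - 1)) powr a)"
    by (rule bounded_expansion_power_series[OF r(2,1) gen_binomial_real s]) auto
  then show ?thesis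
    using r(1) by (auto simp: real_analytic_germ_iff_bounded_expansion)
qed

text \<open>Dividing by the value at the origin normalizes it to 1, where the binomial series with
  exponent -1 applies; positivity near the origin identifies \<open>powr\<close> with the
  inverse.\<close>

lemma real_analytic_germ_inverse:
  fixes f :: "(nat \<Rightarrow> real) \<Rightarrow> real"
  assumes f: "real_analytic_germ k f" and f0: "f origin \<noteq> 0"
  shows "real_analytic_germ k (\<lambda>x. inverse (f x))"
proof (rule real_analytic_germ_cong)
  let ?g = "\<lambda>x. inverse (f origin) * f x"
  have g: "real_analytic_germ k ?g"
    by (intro real_analytic_germ_mult f real_analytic_germ_const)
  show "real_analytic_germ k (\<lambda>x. inverse (f origin) * (?g x powr (- 1)))"
    using f0 by (intro real_analytic_germ_mult[OF real_analytic_germ_const] real_analytic_germ_powr[OF g]) simp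
  have "eventually (\<lambda>x. ?g x > 0) (nhds0 k)"
    using real_analytic_germ_tendsto[OF g] f0 by (intro order_tendstoD(1)) auto
  then show "eventually (\<lambda>x. inverse (f origin) * (?g x powr (- 1)) = inverse (f x)) (nhds0 k)"
    by eventually_elim (use f0 in \<open>simp add: powr_minus\<close>)
qed

lemma real_analytic_germ_divide:
  fixes f g :: "(nat \<Rightarrow> real) \<Rightarrow> real"
  shows "real_analytic_germ k f \<Longrightarrow> real_analytic_germ k g \<Longrightarrow> g origin \<noteq> 0 \<Longrightarrow>
    real_analytic_germ k (\<lambda>x. f x / g x)"
  unfolding divide_inverse by (intro real_analytic_germ_mult real_analytic_germ_inverse)

lemma real_analytic_germ_sqrt:
  fixes f :: "(nat \<Rightarrow> real) \<Rightarrow> real"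
  assumes f: "real_analytic_germ k f" and f1: "f origin = 1"
  shows "real_analytic_germ k (\<lambda>x. sqrt (f x))"
proof (rule real_analytic_germ_cong[OF real_analytic_germ_powr[OF assms, of "1/2"]])
  have "eventually (\<lambda>x. f x > 0) (nhds0 k)"
    using real_analytic_germ_tendsto[OF f] f1 by (intro order_tendstoD(1)) auto
  then show "eventually (\<lambda>x. f x powr (1/2) = sqrt (f x)) (nhds0 k)"
    by eventually_elim (simp add: powr_half_sqrt)
qed

lemmas real_analytic_germ_intros =
  real_analytic_germ_const real_analytic_germ_coordinate real_analytic_germ_add
  real_analytic_germ_mult real_analytic_germ_uminus real_analytic_germ_diff
  real_analytic_germ_sum real_analytic_germ_prod real_analytic_germ_power

section \<open>Vector-valued and matrix-valued germs\<close>

lemma has_sum_vec: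
  fixes f :: "'a \<Rightarrow> 'b::real_normed_vector ^ 'n"
  assumes "\<And>i. ((\<lambda>x. f x $ i) has_sum S $ i) A"
  shows "(f has_sum S) A"
  unfolding has_sum_def
  by (rule vec_tendstoI) (use assms in \<open>simp add: has_sum_def\<close>)

lemma real_analytic_germ_vec:
  fixes f :: "(nat \<Rightarrow> real) \<Rightarrow> 'b::real_normed_vector ^ 'n"
  assumes "\<And>i. real_analytic_germ k (\<lambda>x. f x $ i)"
  shows "real_analytic_germ k f"
proof -
  have "\<forall>i. \<exists>U. openin (Euclidean_space k) U \<and> origin \<in> U \<and>
      (\<forall>a\<in>U. \<exists>c. has_power_series_at k (\<lambda>x. f x $ i) a c)"
    using assms unfolding real_analytic_germ_def by blast
  from choice[OF this] obtain U where U: "\<And>i. openin (Euclidean_space k) (U i)" "\<And>i. origin \<in> U i"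
    "\<And>i a. a \<in> U i \<Longrightarrow> \<exists>c. has_power_series_at k (\<lambda>x. f x $ i) a c"
    by blast
  have "\<exists>c. has_power_series_at k f a c" if a: "a \<in> (\<Inter>i. U i)" for a
  proof -
    have "\<forall>i. \<exists>c. has_power_series_at k (\<lambda>x. f x $ i) a c"
      using U(3) a by blast
    from choice[OF this] obtain c where "\<forall>i. has_power_series_at k (\<lambda>x. f x $ i) a (c i)"
      by blast
    then have "\<forall>i. \<exists>V. openin (Euclidean_space k) V \<and> a \<in> V \<and> (\<forall>x\<in>V.
        ((\<lambda>m. (\<Prod>i<k. (x i - a i) ^ m i) *\<^sub>R c i m) has_sum f x $ i) (multi_indices k))"
      unfolding has_power_series_at_def by blast
    from choice[OF this] obtain V where V: "\<And>i. openin (Euclidean_space k) (V i)" "\<And>i. a \<in> V i"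
      "\<And>i x. x \<in> V i \<Longrightarrow> ((\<lambda>m. (\<Prod>i<k. (x i - a i) ^ m i) *\<^sub>R c i m) has_sum f x $ i) (multi_indices k)"
      by blast
    have "has_power_series_at k f a (\<lambda>m. \<chi> i. c i m)"
      unfolding has_power_series_at_def
      using V by (intro exI[of _ "\<Inter>i. V i"]) (auto intro!: has_sum_vec openin_INT2)
    then show ?thesis by blast
  qed
  then show ?thesis
    unfolding real_analytic_germ_def using U
    by (intro exI[of _ "\<Inter>i. U i"]) (auto intro!: openin_INT2)
qed

lemma real_analytic_germ_matrix:
  fixes f :: "(nat \<Rightarrow> real) \<Rightarrow> real ^ 'm ^ 'n"
  shows "(\<And>i j. real_analytic_germ k (\<lambda>x. f x $ i $ j)) \<Longrightarrow> real_analytic_germ k f"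
  by (intro real_analytic_germ_vec)

lemma real_analytic_germ_bounded_linear:
  assumes h: "bounded_linear h" and f: "real_analytic_germ k f"
  shows "real_analytic_germ k (\<lambda>x. h (f x))"
proof -
  interpret bounded_linear h by fact
  have "has_power_series_at k (\<lambda>x. h (f x)) a (\<lambda>m. h (c m))" if "has_power_series_at k f a c" for a c
    using that has_sum_bounded_linear[OF h] unfolding has_power_series_at_def scaleR[symmetric] by blast
  then show ?thesis
    using f unfolding real_analytic_germ_def by meson
qed

lemma real_analytic_germ_matrix_component:
  fixes f :: "(nat \<Rightarrow> real) \<Rightarrow> real ^ 'm ^ 'n"
  shows "real_analytic_germ k f \<Longrightarrow> real_analytic_germ k (\<lambda>x. f x $ i $ j)"
  by (rule real_analytic_germ_bounded_linear[where h = "\<lambda>M. M $ i $ j"])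
    (auto intro: bounded_linear_compose[OF bounded_linear_vec_nth bounded_linear_vec_nth])

lemma real_analytic_germ_det:
  fixes f :: "(nat \<Rightarrow> real) \<Rightarrow> real ^ 'n ^ 'n"
  shows "(\<And>i j. real_analytic_germ k (\<lambda>x. f x $ i $ j)) \<Longrightarrow> real_analytic_germ k (\<lambda>x. det (f x))"
  unfolding det_def by (intro real_analytic_germ_intros)

section \<open>Quadratic fixed-point equations and factorization of quartics\<close>

text \<open>Picard iteration: with every \<open>e i\<close> of norm at most \<eta>, the iterates
  stay in the ball of radius 2 * \<eta> and the bounds on successive differences halve, so the
  series of differences converges to analytic germs.\<close>

lemma quadratic_fixpoint_germ:
  fixes e :: "'n::finite \<Rightarrow> (nat \<Rightarrow> real) \<Rightarrow> real" and q :: "'n \<Rightarrow> 'n \<Rightarrow> 'n \<Rightarrow> real"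
  assumes e: "\<And>i. real_analytic_germ k (e i)" and e0: "\<And>i. e i origin = 0"
  obtains u where "\<And>i. real_analytic_germ k (u i)" "\<And>i. u i origin = 0"
    "eventually (\<lambda>x. \<forall>i. u i x = e i x + (\<Sum>j\<in>UNIV. \<Sum>l\<in>UNIV. q i j l * (u j x * u l x))) (nhds0 k)"
proof -
  define Q where "Q = (\<Sum>i\<in>UNIV. \<Sum>j\<in>UNIV. \<Sum>l\<in>UNIV. \<bar>q i j l\<bar>)"
  have Q0: "Q \<ge> 0" by (simp add: Q_def sum_nonneg)
  have Qi: "(\<Sum>j\<in>UNIV. \<Sum>l\<in>UNIV. \<bar>q i j l\<bar>) \<le> Q" for i
    unfolding Q_def by (rule member_le_sum[where f = "\<lambda>i. \<Sum>j\<in>UNIV. \<Sum>l\<in>UNIV. \<bar>q i j l\<bar>"]) (auto intro: sum_nonneg)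
  \<comment> \<open>On the ball of radius 2 * \<eta> the quadratic part has Lipschitz constant at
    most 4 * Q * \<eta>, and the 8 makes this at most 1/2. The added 1 covers Q = 0.\<close>
  define \<eta> where "\<eta> = 1 / (8 * (Q + 1))"
  have \<eta>: "\<eta> > 0" "8 * (Q * \<eta>) \<le> 1"
    using Q0 by (auto simp: \<eta>_def field_simps)
  have "\<exists>r>0. bounded_expansion k origin r \<eta> (e i)" for i
    using real_analytic_germ_small[OF e e0 \<eta>(1)] by metis
  then obtain r where r: "r > 0" "\<And>i. bounded_expansion k origin r \<eta> (e i)"
    using bounded_expansion_common_radius[of UNIV k origin "\<lambda>i. \<eta>" e] by auto
  define u where "u = rec_nat (\<lambda>i x. 0)
    (\<lambda>n v i x. e i x + (\<Sum>j\<in>UNIV. \<Sum>l\<in>UNIV. q i j l * (v j x * v l x)))"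
  have u_0: "u 0 = (\<lambda>i x. 0)"
    and u_Suc: "u (Suc n) = (\<lambda>i x. e i x + (\<Sum>j\<in>UNIV. \<Sum>l\<in>UNIV. q i j l * (u n j x * u n l x)))" for n
    by (simp_all add: u_def)
  have u_Suc_i: "u (Suc n) i x = e i x + (\<Sum>j\<in>UNIV. \<Sum>l\<in>UNIV. q i j l * (u n j x * u n l x))" for n i x
    by (simp add: u_Suc)
  have sum_le: "(\<Sum>j\<in>UNIV. \<Sum>l\<in>UNIV. \<bar>q i j l\<bar> * D) \<le> Q * D" if "D \<ge> 0" for i D
    using mult_right_mono[OF Qi[of i] that] by (simp add: sum_distrib_right)
  have B: "bounded_expansion k origin r (2 * \<eta>) (u n i)" for n i
  proof (induction n arbitrary: i)
    case 0
    show ?case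
      using bounded_expansion_mono[OF bounded_expansion_const[of k origin r 0]] \<eta>(1) by (simp add: u_0)
  next
    case (Suc n)
    have "bounded_expansion k origin r (\<eta> + (\<Sum>j\<in>UNIV. \<Sum>l\<in>UNIV. \<bar>q i j l\<bar> * (2 * \<eta> * (2 * \<eta>)))) (u (Suc n) i)"
      unfolding u_Suc using r(1)
      by (intro bounded_expansion_add bounded_expansion_sum bounded_expansion_cmult bounded_expansion_mult r(2) Suc) auto
    moreover have "(\<Sum>j\<in>UNIV. \<Sum>l\<in>UNIV. \<bar>q i j l\<bar> * (2 * \<eta> * (2 * \<eta>))) \<le> \<eta>"
    proof -
      have "(\<Sum>j\<in>UNIV. \<Sum>l\<in>UNIV. \<bar>q i j l\<bar> * (2 * \<eta> * (2 * \<eta>))) \<le> Q * (2 * \<eta> * (2 * \<eta>))"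
        using \<eta>(1) by (intro sum_le) simp
      also have "\<dots> = 8 * (Q * \<eta>) * (\<eta> / 2)" by simp
      also have "\<dots> \<le> 1 * (\<eta> / 2)" using \<eta> by (intro mult_right_mono) auto
      finally show ?thesis using \<eta>(1) by simp
    qed
    ultimately show ?case
      by (elim bounded_expansion_mono) simp
  qed
  have D: "bounded_expansion k origin r (\<eta> * (1/2) ^ n) (\<lambda>x. u (Suc n) i x - u n i x)" for n i
  proof (induction n arbitrary: i)
    case 0
    show ?case using r(2)[of i] by (simp add: u_Suc u_0)
  next
    case (Suc n)
    let ?\<delta> = "\<eta> * (1/2) ^ n"
    \<comment> \<open>A difference of products u v - u' v' is split as u (v - v') + (u - u')
      v'.\<close>
    have "bounded_expansion k origin r (\<Sum>j\<in>UNIV. \<Sum>l\<in>UNIV. \<bar>q i j l\<bar> * (2 * \<eta> * ?\<delta> + ?\<delta> * (2 * \<eta>)))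
      (\<lambda>x. \<Sum>j\<in>UNIV. \<Sum>l\<in>UNIV. q i j l *
        (u (Suc n) j x * (u (Suc n) l x - u n l x) + (u (Suc n) j x - u n j x) * u n l x))"
      using r(1)
      by (intro bounded_expansion_add bounded_expansion_sum bounded_expansion_cmult bounded_expansion_mult Suc B) auto
    also have "(\<lambda>x. \<Sum>j\<in>UNIV. \<Sum>l\<in>UNIV. q i j l *
        (u (Suc n) j x * (u (Suc n) l x - u n l x) + (u (Suc n) j x - u n j x) * u n l x))
      = (\<lambda>x. u (Suc (Suc n)) i x - u (Suc n) i x)"
      unfolding u_Suc_i[of "Suc n" i] u_Suc_i[of n i]
      by (simp add: sum_subtractf[symmetric] algebra_simps)
    finally show ?case
    proof (rule bounded_expansion_mono)
      have "(\<Sum>j\<in>UNIV. \<Sum>l\<in>UNIV. \<bar>q i j l\<bar> * (2 * \<eta> * ?\<delta> + ?\<delta> * (2 * \<eta>)))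
          \<le> Q * (2 * \<eta> * ?\<delta> + ?\<delta> * (2 * \<eta>))"
        using \<eta>(1) by (intro sum_le) simp
      also have "\<dots> = 8 * (Q * \<eta>) * (?\<delta> / 2)" by simp
      also have "\<dots> \<le> 1 * (?\<delta> / 2)" using \<eta> by (intro mult_right_mono) auto
      finally show "(\<Sum>j\<in>UNIV. \<Sum>l\<in>UNIV. \<bar>q i j l\<bar> * (2 * \<eta> * ?\<delta> + ?\<delta> * (2 * \<eta>))) \<le> \<eta> * (1/2) ^ Suc n"
        by simp
    qed
  qed
  \<comment> \<open>The limit is taken as a telescoping series from \<open>u 0\<close>, which is
    zero, because the bounds \<open>D\<close> control exactly its terms.\<close>
  define v where "v i x = suminf (\<lambda>n. u (Suc n) i x - u n i x)" for i x
  have sm: "summable (\<lambda>n. \<eta> * (1/2) ^ n)"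
    by (intro summable_mult summable_geometric) simp
  have d: "summable (\<lambda>n. \<bar>u (Suc n) i x - u n i x\<bar>)" if "x \<in> polybox k origin r" for i x
    by (rule summable_comparison_test'[OF sm]) (use abs_le_bounded_expansion[OF D that] in simp)
  have lim: "(\<lambda>n. u n i x) \<longlonglongrightarrow> v i x" if "x \<in> polybox k origin r" for i x
  proof -
    have "(\<lambda>n. u (Suc n) i x - u n i x) sums v i x"
      unfolding v_def using summable_rabs_cancel[OF d[OF that]] by (rule summable_sums)
    then show ?thesis
      by (simp add: sums_def sum_lessThan_telescope[of "\<lambda>n. u n i x"] u_0)
  qed
  show ?thesis
  proof
    show "real_analytic_germ k (v i)" for i
    proof (rule real_analytic_germI[OF r(1)])
      show "bounded_expansion k origin r (\<Sum>\<^sub>\<infinity>n. \<eta> * (1/2) ^ n) (v i)"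
      proof (rule bounded_expansion_has_sum[OF D _ order_refl _ r(1)])
        show "(\<lambda>n. \<eta> * (1/2) ^ n) summable_on UNIV"
          using sm \<eta>(1) by (intro summable_nonneg_imp_summable_on) auto
        show "((\<lambda>n. u (Suc n) i x - u n i x) has_sum v i x) UNIV" if "x \<in> polybox k origin r" for x
          unfolding v_def real_norm_def[symmetric]
          by (rule norm_summable_imp_has_sum[OF _ summable_sums[OF summable_rabs_cancel[OF d[OF that]]]])
            (use d[OF that] in simp)
      qed
    qed
    have "u n i origin = 0" for n i
      by (induction n arbitrary: i) (simp_all add: u_0 u_Suc e0)
    then show "v i origin = 0" for i
      by (simp add: v_def)
    show "eventually (\<lambda>x. \<forall>i. v i x = e i x + (\<Sum>j\<in>UNIV. \<Sum>l\<in>UNIV. q i j l * (v j x * v l x))) (nhds0 k)"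
      using eventually_polybox[OF r(1)]
    proof eventually_elim
      case (elim x)
      show ?case
      proof
        fix i
        have "(\<lambda>n. u (Suc n) i x) \<longlonglongrightarrow> e i x + (\<Sum>j\<in>UNIV. \<Sum>l\<in>UNIV. q i j l * (v j x * v l x))"
          unfolding u_Suc by (intro tendsto_intros lim elim)
        moreover have "(\<lambda>n. u (Suc n) i x) \<longlonglongrightarrow> v i x"
          using lim[OF elim] by (rule LIMSEQ_Suc)
        ultimately show "v i x = e i x + (\<Sum>j\<in>UNIV. \<Sum>l\<in>UNIV. q i j l * (v j x * v l x))"
          by (rule LIMSEQ_unique[rotated])
      qed
    qed
  qed
qed

text \<open>Solving the linear parts of the four equations for \<open>a\<close>, \<open>b\<close>, \<open>c\<close> and \<open>d - 1\<close> leaves a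
  fixed-point equation with a quadratic nonlinearity.\<close>

lemma quartic_factor_germ:
  fixes p0 p1 p2 p3 :: "(nat \<Rightarrow> real) \<Rightarrow> real"
  assumes p: "real_analytic_germ k p0" "real_analytic_germ k p1" "real_analytic_germ k p2" "real_analytic_germ k p3"
    and p_origin: "p0 origin = 0" "p1 origin = 0" "p2 origin = 1" "p3 origin = 0"
  obtains a b c d where
    "real_analytic_germ k a" "real_analytic_germ k b" "real_analytic_germ k c" "real_analytic_germ k d"
    "a origin = 0" "b origin = 0" "c origin = 0" "d origin = 1"
    "eventually (\<lambda>x. p3 x = a x + c x \<and> p2 x = b x + d x + a x * c x \<and>
      p1 x = a x * d x + b x * c x \<and> p0 x = b x * d x) (nhds0 k)"
proof -
  \<comment> \<open>The indices 1, 2, 3, 4 stand for a, b, c, d - 1. The linear parts a, b, a + c, b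
    + (d - 1) come from p1, p0, p3, p2; eliminating a and b from the last two explains the
    differences in \<open>\<epsilon>\<close> and the opposite signs in \<open>q\<close>.\<close>
  define \<epsilon> :: "4 \<Rightarrow> (nat \<Rightarrow> real) \<Rightarrow> real" where
    "\<epsilon> i = (if i = 1 then p1 else if i = 2 then p0 else if i = 3 then (\<lambda>x. p3 x - p1 x)
      else (\<lambda>x. p2 x - 1 - p0 x))" for i
  define q :: "4 \<Rightarrow> 4 \<Rightarrow> 4 \<Rightarrow> real" where
    "q i j l =
      (if i = 1 then (if j = 1 \<and> l = 4 \<or> j = 2 \<and> l = 3 then - 1 else 0)
       else if i = 2 then (if j = 2 \<and> l = 4 then - 1 else 0)
       else if i = 3 then (if j = 1 \<and> l = 4 \<or> j = 2 \<and> l = 3 then 1 else 0)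
       else (if j = 2 \<and> l = 4 then 1 else if j = 1 \<and> l = 3 then - 1 else 0))" for i j l
  obtain u where u: "\<And>i. real_analytic_germ k (u i)" "\<And>i. u i origin = 0"
    "eventually (\<lambda>x. \<forall>i. u i x = \<epsilon> i x + (\<Sum>j\<in>UNIV. \<Sum>l\<in>UNIV. q i j l * (u j x * u l x))) (nhds0 k)"
  proof (rule quadratic_fixpoint_germ[of k \<epsilon> q])
    show "real_analytic_germ k (\<epsilon> i)" for i
      unfolding \<epsilon>_def using p by (auto intro!: real_analytic_germ_intros)
    show "\<epsilon> i origin = 0" for i
      using p_origin by (simp add: \<epsilon>_def)
  qed blast
  show ?thesis
  proof (rule that[of "u 1" "u 2" "u 3" "\<lambda>x. 1 + u 4 x"])
    show "real_analytic_germ k (\<lambda>x. 1 + u 4 x)"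
      by (intro real_analytic_germ_intros u)
    show "eventually (\<lambda>x. p3 x = u 1 x + u 3 x \<and> p2 x = u 2 x + (1 + u 4 x) + u 1 x * u 3 x \<and>
      p1 x = u 1 x * (1 + u 4 x) + u 2 x * u 3 x \<and> p0 x = u 2 x * (1 + u 4 x)) (nhds0 k)"
      using u(3)
    proof eventually_elim
      case (elim x)
      have "u 1 x = p1 x - u 1 x * u 4 x - u 2 x * u 3 x"
        using elim[rule_format, of 1] by (simp add: sum_4 \<epsilon>_def q_def)
      moreover have "u 2 x = p0 x - u 2 x * u 4 x"
        using elim[rule_format, of 2] by (simp add: sum_4 \<epsilon>_def q_def)
      moreover have "u 3 x = p3 x - p1 x + u 1 x * u 4 x + u 2 x * u 3 x"
        using elim[rule_format, of 3] by (simp add: sum_4 \<epsilon>_def q_def)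
      moreover have "u 4 x = p2 x - 1 - p0 x + u 2 x * u 4 x - u 1 x * u 3 x"
        using elim[rule_format, of 4] by (simp add: sum_4 \<epsilon>_def q_def)
      ultimately show ?case
        by (simp add: distrib_left)
    qed
  qed (auto simp: u)
qed

section \<open>Versality\<close>

lemma vector_4 [simp]:
  "(vector [a, b, c, d] :: ('a::zero)^4) $ 1 = a" "(vector [a, b, c, d] :: ('a::zero)^4) $ 2 = b"
  "(vector [a, b, c, d] :: ('a::zero)^4) $ 3 = c" "(vector [a, b, c, d] :: ('a::zero)^4) $ 4 = d"
  unfolding vector_def by simp_all

lemma matrix_inv_cancel:
  assumes "invertible A"
  shows "A ** matrix_inv A = mat 1" "matrix_inv A ** A = mat 1"
proof -
  have "A ** matrix_inv A = mat 1 \<and> matrix_inv A ** A = mat 1"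
    using assms unfolding invertible_def matrix_inv_def by (rule someI_ex)
  then show "A ** matrix_inv A = mat 1" "matrix_inv A ** A = mat 1" by auto
qed

lemma conjugate_eqI:
  fixes C :: "real^'n^'n"
  shows "invertible C \<Longrightarrow> M ** C = C ** N \<Longrightarrow> M = C ** N ** matrix_inv C"
  by (metis matrix_inv_cancel(1) matrix_mul_assoc matrix_mul_rid)

lemma matrix_vector_mult_minus: "M *v (- y) = - (M *v y)" for M :: "real^'m^'n"
  by (simp add: vec_eq_iff matrix_vector_mult_def sum_negf)

text \<open>The diagonal blocks are companion matrices of \<lambda>^2 + \<delta>1 \<lambda> +
  \<Omega> and \<lambda>^2 + \<delta>2 \<lambda> + 1, so the parameters are coefficients of two
  quadratic factors.\<close>

lemma A0_plus_damping:
  "A0 + damping_matrix \<Omega> \<delta>1 \<delta>2 =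
    vector [vector [0, 1, 0, 0], vector [- \<Omega>, - \<delta>1, 0, 0],
      vector [0, 0, 0, 1], vector [0, 0, - 1, - \<delta>2]]"
  by (simp add: A0_def damping_matrix_def vec_eq_iff forall_4)

lemma A0_plus_damping_origin: "A0 + damping_matrix 0 0 0 = A0"
  unfolding A0_plus_damping unfolding A0_def by simp

lemma deformation_A0_plus_damping:
  "deformation A0 3 (\<lambda>x. A0 + damping_matrix (x 0) (x 1) (x 2))"
proof -
  have "\<forall>i j. real_analytic_germ 3 (\<lambda>x. (A0 + damping_matrix (x 0) (x 1) (x 2)) $ i $ j)"
    by (simp add: A0_plus_damping forall_4 real_analytic_germ_intros)
  then show ?thesis
    by (auto simp: deformation_def origin_def A0_plus_damping_origin intro: real_analytic_germ_matrix)
qed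

text \<open>In the basis s (M f + a f), f the matrix s M sends the first vector to -s^2 b f and f to
  the first vector minus s a f, which is a companion block. The same holds for g, where s^2 d = 1
  produces the fixed entry. This is only an intertwining relation; invertibility of C is a separate
  matter.\<close>

lemma companion_conjugation:
  fixes M :: "real^4^4" and f g :: "real^4"
  assumes f: "M *v (M *v f) + a *\<^sub>R (M *v f) + b *\<^sub>R f = 0"
    and g: "M *v (M *v g) + c *\<^sub>R (M *v g) + d *\<^sub>R g = 0"
    and s: "s\<^sup>2 * d = 1"
    and C: "\<And>i. C $ i = vector [s * ((M *v f) $ i + a * f $ i), f $ i, s * ((M *v g) $ i + c * g $ i), g $ i]"
  shows "(s *\<^sub>R M) ** C = C ** (A0 + damping_matrix (s\<^sup>2 * b) (s * a) (s * c))"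
proof -
  have f': "(M *v (M *v f)) $ i = - a * (M *v f) $ i - b * f $ i"
    and g': "(M *v (M *v g)) $ i = - c * (M *v g) $ i - d * g $ i" for i
    using arg_cong[OF f, of "\<lambda>v. v $ i"] arg_cong[OF g, of "\<lambda>v. v $ i"] by simp_all
  have mv: "(\<Sum>k\<in>UNIV. M $ i $ k * (t * (y $ k + r * z $ k))) = t * ((M *v y) $ i + r * (M *v z) $ i)" 
    for i t r and y z :: "real^4"
    by (simp add: matrix_vector_mult_def sum_4 algebra_simps)
  have mv': "(\<Sum>k\<in>UNIV. M $ i $ k * y $ k) = (M *v y) $ i" for i and y :: "real^4"
    by (simp add: matrix_vector_mult_def)
  have L: "((s *\<^sub>R M) ** C) $ i $ j = s * (\<Sum>k\<in>UNIV. M $ i $ k * C $ k $ j)" for i j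
    by (simp add: matrix_matrix_mult_def sum_distrib_left mult.assoc)
  have s': "d * (s * (s * z)) = z" for z
  proof -
    have "d * (s * (s * z)) = (s\<^sup>2 * d) * z" by (simp add: power2_eq_square)
    then show ?thesis by (simp add: s)
  qed
  have "\<forall>j. ((s *\<^sub>R M) ** C) $ i $ j = (C ** (A0 + damping_matrix (s\<^sup>2 * b) (s * a) (s * c))) $ i $ j" for i
    unfolding forall_4 L
    by (simp add: C mv mv' f' g' A0_plus_damping matrix_matrix_mult_def[of C])
      (simp add: sum_4 power2_eq_square algebra_simps s')
  then show ?thesis by (simp add: vec_eq_iff)
qed

text \<open>The sum of a generator of the nilpotent block and a vector of the rotation block. It is
  cyclic for \<open>A0\<close> because the two blocks have coprime characteristic
  polynomials.\<close>

abbreviation cyclic_vector :: "real^4" where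
  "cyclic_vector \<equiv> vector [0, 1, 0, 1]"

lemma A0_mult_vector: "A0 *v vector [a, b, c, d] = vector [b, 0, d, - c]"
  by (simp add: A0_def vec_eq_iff forall_4 matrix_vector_mult_def sum_4)

lemma real_analytic_germ_matrix_vector_mult:
  fixes M :: "(nat \<Rightarrow> real) \<Rightarrow> real^'m^'n"
  assumes "\<And>i j. real_analytic_germ k (\<lambda>x. M x $ i $ j)" "\<And>j. real_analytic_germ k (\<lambda>x. v x $ j)"
  shows "real_analytic_germ k (\<lambda>x. (M x *v v x) $ i)"
  unfolding matrix_vector_mult_def by (simp add: real_analytic_germ_intros assms)

text \<open>\<open>A0\<close> is nonderogatory, so nearby matrices keep its cyclic vector, and Cramer's rule expresses
  the coefficients of the characteristic polynomial analytically.\<close>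

lemma cyclic_vector_relation_germ:
  fixes B :: "(nat \<Rightarrow> real) \<Rightarrow> real^4^4"
  assumes B: "\<And>i j. real_analytic_germ k (\<lambda>x. B x $ i $ j)" and B0: "B origin = A0"
  defines "v \<equiv> \<lambda>n x. ((\<lambda>y. B x *v y) ^^ n) cyclic_vector"
  obtains p0 p1 p2 p3 where
    "real_analytic_germ k p0" "real_analytic_germ k p1" "real_analytic_germ k p2" "real_analytic_germ k p3"
    "p0 origin = 0" "p1 origin = 0" "p2 origin = 1" "p3 origin = 0"
    "eventually (\<lambda>x. v 4 x + p3 x *\<^sub>R v 3 x + p2 x *\<^sub>R v 2 x + p1 x *\<^sub>R v (Suc 0) x + p0 x *\<^sub>R v 0 x = 0) (nhds0 k)"
proof -
  have v: "real_analytic_germ k (\<lambda>x. v n x $ i)" for n i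
  proof (induction n arbitrary: i)
    case (Suc n)
    then show ?case
      unfolding v_def by (simp add: real_analytic_germ_matrix_vector_mult B)
  qed (simp add: v_def real_analytic_germ_const)
  have v_origin: "v 0 origin = vector [0, 1, 0, 1]" "v (Suc 0) origin = vector [1, 0, 1, 0]"
    "v 2 origin = vector [0, 0, 0, - 1]" "v 3 origin = vector [0, 0, - 1, 0]" "v 4 origin = vector [0, 0, 0, 1]"
    by (simp_all add: v_def B0 A0_mult_vector eval_nat_numeral)
  define K :: "(nat \<Rightarrow> real) \<Rightarrow> real^4^4" where
    "K x = (\<chi> i. vector [v 0 x $ i, v (Suc 0) x $ i, v 2 x $ i, v 3 x $ i])" for x
  define y :: "(nat \<Rightarrow> real) \<Rightarrow> real^4" where
    "y x = (\<chi> l. det (\<chi> i j. if j = l then v 4 x $ i else K x $ i $ j) / det (K x))" for x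
  have "\<forall>j i. real_analytic_germ k (\<lambda>x. K x $ i $ j)"
    unfolding forall_4[where P = "\<lambda>j. \<forall>i. real_analytic_germ k (\<lambda>x. K x $ i $ j)"] by (simp add: K_def v)
  then have K: "real_analytic_germ k (\<lambda>x. K x $ i $ j)" for i j by blast
  have "K origin ** K origin = mat 1"
    by (simp add: K_def v_origin matrix_matrix_mult_def sum_4 vec_eq_iff forall_4 mat_def)
  then have dK0: "det (K origin) \<noteq> 0"
    unfolding invertible_det_nz[symmetric] invertible_def by blast
  have dK: "real_analytic_germ k (\<lambda>x. det (K x))"
    by (rule real_analytic_germ_det[OF K])
  have y: "real_analytic_germ k (\<lambda>x. y x $ l)" for l
  proof -
    have "real_analytic_germ k (\<lambda>x. det (\<chi> i j. if j = l then v 4 x $ i else K x $ i $ j))"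
    proof (rule real_analytic_germ_det)
      show "real_analytic_germ k (\<lambda>x. (\<chi> i j. if j = l then v 4 x $ i else K x $ i $ j) $ i $ j)" for i j
        by (cases "j = l") (simp_all add: v K)
    qed
    then show ?thesis
      unfolding y_def by (simp add: real_analytic_germ_divide dK dK0)
  qed
  have Ky: "K x *v z = z $ 1 *\<^sub>R v 0 x + z $ 2 *\<^sub>R v (Suc 0) x + z $ 3 *\<^sub>R v 2 x + z $ 4 *\<^sub>R v 3 x" for x z
    by (simp add: K_def matrix_vector_mult_def sum_4 vec_eq_iff mult.commute)
  \<comment> \<open>The characteristic polynomial of \<open>A0\<close> is \<lambda>^4 + \<lambda>^2,
    so the fourth image of the cyclic vector is minus the second.\<close>
  have "K origin *v vector [0, 0, - 1, 0] = v 4 origin"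
    by (simp add: Ky v_origin vec_eq_iff forall_4)
  then have y_origin: "y origin = vector [0, 0, - 1, 0]"
    using cramer[OF dK0, of "vector [0, 0, - 1, 0]" "v 4 origin"] by (simp add: y_def)
  show ?thesis
  proof (rule that[of "\<lambda>x. - y x $ 1" "\<lambda>x. - y x $ 2" "\<lambda>x. - y x $ 3" "\<lambda>x. - y x $ 4"])
    have "eventually (\<lambda>x. det (K x) \<noteq> 0) (nhds0 k)"
      using real_analytic_germ_tendsto[OF dK] dK0 by (rule tendsto_imp_eventually_ne)
    then show "eventually (\<lambda>x. v 4 x + - y x $ 4 *\<^sub>R v 3 x + - y x $ 3 *\<^sub>R v 2 x + - y x $ 2 *\<^sub>R v (Suc 0) x
      + - y x $ 1 *\<^sub>R v 0 x = 0) (nhds0 k)"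
    proof eventually_elim
      case (elim x)
      have "K x *v y x = v 4 x"
        unfolding cramer[OF elim] y_def ..
      then show ?case
        by (simp add: Ky algebra_simps)
    qed
  qed (auto simp: y_origin intro!: real_analytic_germ_intros y)
qed

text \<open>Up to one square root, all data are arithmetic expressions in the factor coefficients
  and the vectors B^n w, so they are germs. The conjugation holds where the factorization, d > 0 and
  det C \<noteq> 0 are simultaneously in force.\<close>

lemma versal_A0_plus_damping:
  "versal_up_to_time_rescaling A0 3 (\<lambda>x. A0 + damping_matrix (x 0) (x 1) (x 2))"
  unfolding versal_up_to_time_rescaling_def
proof (intro conjI allI impI deformation_A0_plus_damping)
  fix k and B :: "(nat \<Rightarrow> real) \<Rightarrow> real^4^4"
  assume "deformation A0 k B"
  then have B: "\<And>i j. real_analytic_germ k (\<lambda>x. B x $ i $ j)" and B0: "B origin = A0"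
    by (auto simp: deformation_def intro: real_analytic_germ_matrix_component)
  define v where "v n x = ((\<lambda>y. B x *v y) ^^ n) cyclic_vector" for n x
  have v: "real_analytic_germ k (\<lambda>x. v n x $ i)" for n i
  proof (induction n arbitrary: i)
    case (Suc n)
    then show ?case
      unfolding v_def by (simp add: real_analytic_germ_matrix_vector_mult B)
  qed (simp add: v_def real_analytic_germ_const)
  have v_origin: "v 0 origin = vector [0, 1, 0, 1]" "v (Suc 0) origin = vector [1, 0, 1, 0]"
    "v 2 origin = vector [0, 0, 0, - 1]" "v 3 origin = vector [0, 0, - 1, 0]"
    by (simp_all add: v_def B0 A0_mult_vector eval_nat_numeral)
  have Bv: "B x *v v 0 x = v (Suc 0) x" "B x *v v (Suc 0) x = v 2 x" "B x *v v 2 x = v 3 x" "B x *v v 3 x = v 4 x" for x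
    by (simp_all add: v_def eval_nat_numeral)
  obtain p0 p1 p2 p3 where p:
    "real_analytic_germ k p0" "real_analytic_germ k p1" "real_analytic_germ k p2" "real_analytic_germ k p3"
    "p0 origin = 0" "p1 origin = 0" "p2 origin = 1" "p3 origin = 0"
    and p_rel: "eventually (\<lambda>x. v 4 x + p3 x *\<^sub>R v 3 x + p2 x *\<^sub>R v 2 x + p1 x *\<^sub>R v (Suc 0) x + p0 x *\<^sub>R v 0 x = 0) (nhds0 k)"
    unfolding v_def by (rule cyclic_vector_relation_germ[OF B B0]) blast
  obtain a b c d where an: "real_analytic_germ k a" "real_analytic_germ k b" "real_analytic_germ k c" "real_analytic_germ k d"
    and abcd0: "a origin = 0" "b origin = 0" "c origin = 0" "d origin = 1"
    and fac: "eventually (\<lambda>x. p3 x = a x + c x \<and> p2 x = b x + d x + a x * c x \<and>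
      p1 x = a x * d x + b x * c x \<and> p0 x = b x * d x) (nhds0 k)"
    by (rule quartic_factor_germ[OF p]) blast
  \<comment> \<open>This choice turns the constant term of the second factor into s^2 d = 1.\<close>
  define s where "s x = 1 / sqrt (d x)" for x
  have s: "real_analytic_germ k s" "s origin = 1"
    unfolding s_def using abcd0
    by (auto intro!: real_analytic_germ_divide real_analytic_germ_const real_analytic_germ_sqrt an)
  \<comment> \<open>\<open>f = r(B) w\<close> and \<open>g = - q(B) w\<close>, so \<open>q(B) f = r(B) g = 0\<close>; the sign makes \<open>C origin = mat 1\<close>.\<close>
  define f where "f x = v 2 x + c x *\<^sub>R v (Suc 0) x + d x *\<^sub>R v 0 x" for x
  define g where "g x = - (v 2 x + a x *\<^sub>R v (Suc 0) x + b x *\<^sub>R v 0 x)" for x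
  have Bf: "B x *v f x = v 3 x + c x *\<^sub>R v 2 x + d x *\<^sub>R v (Suc 0) x"
    "B x *v (B x *v f x) = v 4 x + c x *\<^sub>R v 3 x + d x *\<^sub>R v 2 x" for x
    by (simp_all add: f_def matrix_vector_right_distrib matrix_vector_mult_scaleR Bv)
  have Bg: "B x *v g x = - (v 3 x + a x *\<^sub>R v 2 x + b x *\<^sub>R v (Suc 0) x)"
    "B x *v (B x *v g x) = - (v 4 x + a x *\<^sub>R v 3 x + b x *\<^sub>R v 2 x)" for x
    by (simp_all only: g_def matrix_vector_mult_minus matrix_vector_right_distrib matrix_vector_mult_scaleR Bv)
  define C :: "(nat \<Rightarrow> real) \<Rightarrow> real^4^4" where
    "C x = (\<chi> i. vector [s x * ((B x *v f x) $ i + a x * f x $ i), f x $ i,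
      s x * ((B x *v g x) $ i + c x * g x $ i), g x $ i])" for x
  have fg: "real_analytic_germ k (\<lambda>x. f x $ i)" "real_analytic_germ k (\<lambda>x. g x $ i)" for i
    by (simp_all add: f_def g_def real_analytic_germ_intros v an)
  have Bfg: "real_analytic_germ k (\<lambda>x. (B x *v f x) $ i)" "real_analytic_germ k (\<lambda>x. (B x *v g x) $ i)" for i
    by (intro real_analytic_germ_matrix_vector_mult B fg)+
  have "\<forall>j i. real_analytic_germ k (\<lambda>x. C x $ i $ j)"
    unfolding forall_4[where P = "\<lambda>j. \<forall>i. real_analytic_germ k (\<lambda>x. C x $ i $ j)"]
    by (simp add: C_def real_analytic_germ_intros fg Bfg an s)
  then have C: "real_analytic_germ k (\<lambda>x. C x $ i $ j)" for i j by blast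
  have C0: "C origin = mat 1"
    unfolding C_def Bf Bg by (simp add: f_def g_def abcd0 s v_origin vec_eq_iff forall_4 mat_def)
  \<comment> \<open>These are the coefficients of the factors after scaling the roots by s; the
    value 0 at other indices keeps the point in \<open>Euclidean_space 3\<close>.\<close>
  define \<phi> :: "(nat \<Rightarrow> real) \<Rightarrow> nat \<Rightarrow> real" where
    "\<phi> x = (\<lambda>i. if i = 0 then (s x)\<^sup>2 * b x else if i = 1 then s x * a x else if i = 2 then s x * c x else 0)" for x
  have \<phi>: "real_analytic_map_germ k 3 \<phi>"
    unfolding real_analytic_map_germ_def
  proof (intro conjI allI impI)
    show "\<phi> origin = origin"
      using abcd0 by (auto simp: \<phi>_def fun_eq_iff origin_def)
    show "\<exists>U. openin (Euclidean_space k) U \<and> origin \<in> U \<and> (\<forall>x\<in>U. \<phi> x \<in> topspace (Euclidean_space 3))"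
    proof (intro exI conjI ballI)
      show "\<phi> x \<in> topspace (Euclidean_space 3)" for x
        by (simp add: \<phi>_def topspace_Euclidean_space)
    qed (rule openin_topspace origin_in_Euclidean_space)+
    show "real_analytic_germ k (\<lambda>x. \<phi> x i)" if "i < 3" for i
      by (cases "i = 0"; cases "i = 1"; cases "i = 2") (simp_all add: \<phi>_def real_analytic_germ_intros an s)
  qed
  have dpos: "eventually (\<lambda>x. d x > 0) (nhds0 k)"
    using real_analytic_germ_tendsto[OF an(4)] abcd0 by (intro order_tendstoD(1)) auto
  have "eventually (\<lambda>x. det (C x) \<noteq> 0) (nhds0 k)"
    by (rule tendsto_imp_eventually_ne[OF real_analytic_germ_tendsto[OF real_analytic_germ_det[OF C]]])
      (simp add: C0)
  with p_rel fac dpos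
  have "eventually (\<lambda>x. s x > 0 \<and> invertible (C x) \<and>
    s x *\<^sub>R B x = C x ** (A0 + damping_matrix (\<phi> x 0) (\<phi> x 1) (\<phi> x 2)) ** matrix_inv (C x)) (nhds0 k)"
  proof eventually_elim
    case (elim x)
    have inv: "invertible (C x)"
      using elim by (simp add: invertible_det_nz)
    \<comment> \<open>Once v 4 is eliminated through the factored relation, both annihilation
      identities are linear identities in v 0, ..., v 3.\<close>
    have rel: "v 4 x = - ((a x + c x) *\<^sub>R v 3 x + (b x + d x + a x * c x) *\<^sub>R v 2 x
        + (a x * d x + b x * c x) *\<^sub>R v (Suc 0) x + (b x * d x) *\<^sub>R v 0 x)"
      by (rule eq_neg_iff_add_eq_0[THEN iffD2]) (use elim in \<open>simp add: add.assoc\<close>)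
    have "(s x *\<^sub>R B x) ** C x = C x ** (A0 + damping_matrix ((s x)\<^sup>2 * b x) (s x * a x) (s x * c x))"
    proof (rule companion_conjugation)
      show "B x *v (B x *v f x) + a x *\<^sub>R (B x *v f x) + b x *\<^sub>R f x = 0"
        unfolding Bf(2) unfolding Bf(1) unfolding f_def rel by (simp add: algebra_simps)
      show "B x *v (B x *v g x) + c x *\<^sub>R (B x *v g x) + d x *\<^sub>R g x = 0"
        unfolding Bg(2) unfolding Bg(1) unfolding g_def rel by (simp add: algebra_simps)
      show "(s x)\<^sup>2 * d x = 1"
        using elim by (simp add: s_def power_divide)
    qed (simp add: C_def)
    then have "s x *\<^sub>R B x = C x ** (A0 + damping_matrix (\<phi> x 0) (\<phi> x 1) (\<phi> x 2)) ** matrix_inv (C x)"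
      using inv by (intro conjugate_eqI) (simp_all add: \<phi>_def)
    then show ?case
      using inv elim by (simp add: s_def)
  qed
  then show "\<exists>\<phi> s C. real_analytic_map_germ k 3 \<phi> \<and> real_analytic_germ k s \<and> s origin = 1 \<and>
      real_analytic_germ k C \<and> C origin = mat 1 \<and>
      (\<exists>U. openin (Euclidean_space k) U \<and> origin \<in> U \<and>
        (\<forall>\<mu>\<in>U. s \<mu> > 0 \<and> invertible (C \<mu>) \<and>
          s \<mu> *\<^sub>R B \<mu> = C \<mu> ** (A0 + damping_matrix (\<phi> \<mu> 0) (\<phi> \<mu> 1) (\<phi> \<mu> 2)) ** matrix_inv (C \<mu>)))"
    unfolding eventually_nhds0 using \<phi> s C0 real_analytic_germ_matrix[of k C, OF C] by blast
qed

section \<open>Minimality\<close>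

lemma trace_conjugate:
  fixes C :: "real^'n^'n"
  shows "invertible C \<Longrightarrow> trace (C ** X ** matrix_inv C) = trace X"
  by (metis matrix_inv_cancel(2) matrix_mul_assoc matrix_mul_lid trace_mul_sym)

lemma conjugate_mult:
  fixes C :: "real^'n^'n"
  assumes "invertible C"
  shows "(C ** X ** matrix_inv C) ** (C ** Y ** matrix_inv C) = C ** (X ** Y) ** matrix_inv C"
proof -
  have "(C ** X ** matrix_inv C) ** (C ** Y ** matrix_inv C) = C ** X ** (matrix_inv C ** C) ** Y ** matrix_inv C"
    by (simp add: matrix_mul_assoc)
  then show ?thesis
    by (simp add: matrix_inv_cancel assms matrix_mul_assoc)
qed

text \<open>These are the power sums of the roots of \<lambda>^2 + a \<lambda> + b and \<lambda>^2 +
  c \<lambda> + d, the characteristic polynomials of the scaled blocks. The scaling factor survives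
  in d.\<close>

lemma traces_scaled_A0_plus_damping:
  fixes s \<Omega> \<delta>1 \<delta>2 :: real
  defines "M \<equiv> s *\<^sub>R (A0 + damping_matrix \<Omega> \<delta>1 \<delta>2)"
    and "a \<equiv> s * \<delta>1" and "b \<equiv> s\<^sup>2 * \<Omega>" and "c \<equiv> s * \<delta>2" and "d \<equiv> s\<^sup>2"
  shows "trace M = - (a + c)"
    and "trace (M ** M) = a\<^sup>2 + c\<^sup>2 - 2 * b - 2 * d"
    and "trace (M ** M ** M) = 3 * a * b + 3 * c * d - a ^ 3 - c ^ 3"
    and "trace (M ** M ** M ** M) = a ^ 4 - 4 * a\<^sup>2 * b + 2 * b\<^sup>2 + c ^ 4 - 4 * c\<^sup>2 * d + 2 * d\<^sup>2"
proof -
  have M: "M = vector [vector [0, s, 0, 0], vector [- s * \<Omega>, - a, 0, 0],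
      vector [0, 0, 0, s], vector [0, 0, - s, - c]]"
    unfolding M_def A0_plus_damping by (simp add: vec_eq_iff forall_4 a_def c_def)
  have M2: "M ** M = vector [vector [- b, - s * a, 0, 0], vector [s * \<Omega> * a, a\<^sup>2 - b, 0, 0],
      vector [0, 0, - d, - s * c], vector [0, 0, s * c, c\<^sup>2 - d]]"
    by (simp add: M vec_eq_iff forall_4 matrix_matrix_mult_def sum_4 b_def d_def power2_eq_square)
  have M3: "M ** M ** M = vector [vector [a * b, s * (a\<^sup>2 - b), 0, 0],
      vector [- s * \<Omega> * (a\<^sup>2 - b), 2 * a * b - a ^ 3, 0, 0],
      vector [0, 0, c * d, s * (c\<^sup>2 - d)], vector [0, 0, - s * (c\<^sup>2 - d), 2 * c * d - c ^ 3]]"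
    unfolding M2 unfolding M
    by (simp add: vec_eq_iff forall_4 matrix_matrix_mult_def sum_4 b_def d_def
        power2_eq_square power3_eq_cube algebra_simps)
  show "trace M = - (a + c)"
    by (simp add: M trace_def sum_4)
  show "trace (M ** M) = a\<^sup>2 + c\<^sup>2 - 2 * b - 2 * d"
    by (simp add: M2 trace_def sum_4)
  show "trace (M ** M ** M) = 3 * a * b + 3 * c * d - a ^ 3 - c ^ 3"
    by (simp add: M3 trace_def sum_4)
  show "trace (M ** M ** M ** M) = a ^ 4 - 4 * a\<^sup>2 * b + 2 * b\<^sup>2 + c ^ 4 - 4 * c\<^sup>2 * d + 2 * d\<^sup>2"
    unfolding M3 unfolding M
    by (simp add: trace_def matrix_matrix_mult_def sum_4 b_def d_def
        power2_eq_square power3_eq_cube power4_eq_xxxx algebra_simps)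
qed

text \<open>Multiplication of quadratics is injective near the coprime pair \<lambda>^2, \<lambda>^2
  + 1. Since c - c' = -A, the differences satisfy a system with linear part B = 0, B + D = 0, A = 0;
  the tolerance 1/10 makes all other terms too small to permit a nonzero solution.\<close>

lemma quadratic_factors_unique:
  fixes a b c d a' b' c' d' :: real
  assumes 3: "a + c = a' + c'" and 2: "b + d + a * c = b' + d' + a' * c'"
    and 1: "a * d + b * c = a' * d' + b' * c'" and 0: "b * d = b' * d'"
    and small: "\<bar>a\<bar> \<le> 1/10" "\<bar>b\<bar> \<le> 1/10" "\<bar>c\<bar> \<le> 1/10" "\<bar>d - 1\<bar> \<le> 1/10"
      "\<bar>a'\<bar> \<le> 1/10" "\<bar>b'\<bar> \<le> 1/10" "\<bar>c'\<bar> \<le> 1/10" "\<bar>d' - 1\<bar> \<le> 1/10"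
  shows "a = a' \<and> b = b' \<and> c = c' \<and> d = d'"
proof -
  define A B D where "A = a - a'" and "B = b - b'" and "D = d - d'"
  have c': "c' = a + c - a'" using 3 by simp
  have m: "\<bar>y * x\<bar> \<le> \<bar>y\<bar> / 10" if "\<bar>x\<bar> \<le> 1/10" for x y :: real
    using mult_left_mono[OF that, of "\<bar>y\<bar>"] by (simp add: abs_mult)
  have tri: "\<bar>x\<bar> \<le> p + q + r + t"
    if "x = - y - z - v + w" "\<bar>y\<bar> \<le> p" "\<bar>z\<bar> \<le> q" "\<bar>v\<bar> \<le> r" "\<bar>w\<bar> \<le> t" for x y z v w p q r t :: real
    using that by linarith
  \<comment> \<open>The zero summands pad this equation, and \<open>e2\<close> below, to the
    four-term shape of \<open>tri\<close>.\<close>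
  have e0: "B = - (B * (d - 1)) - D * b' - 0 + 0"
    using 0 unfolding B_def D_def by (simp add: algebra_simps)
  have "B + D + A * c - A * a' = (b + d + a * c) - (b' + d' + a' * c')"
    unfolding A_def B_def D_def c' by (simp add: algebra_simps)
  then have e2: "D = - B - A * c - 0 + A * a'"
    using 2 by simp
  have "A * d + D * a' + B * c - A * b' = (a * d + b * c) - (a' * d' + b' * c')"
    unfolding A_def B_def D_def c' by (simp add: algebra_simps)
  then have e1: "A = - (A * (d - 1)) - D * a' - B * c + A * b'"
    using 1 by (simp add: algebra_simps)
  have "\<bar>B\<bar> \<le> \<bar>B\<bar> / 10 + \<bar>D\<bar> / 10 + 0 + 0"
    by (rule tri[OF e0]) ((rule m small | simp)+)
  moreover have "\<bar>D\<bar> \<le> \<bar>B\<bar> + \<bar>A\<bar> / 10 + 0 + \<bar>A\<bar> / 10"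
    by (rule tri[OF e2]) ((rule m small | simp)+)
  moreover have "\<bar>A\<bar> \<le> \<bar>A\<bar> / 10 + \<bar>D\<bar> / 10 + \<bar>B\<bar> / 10 + \<bar>A\<bar> / 10"
    by (rule tri[OF e1]) ((rule m small | simp)+)
  ultimately have "A = 0" "B = 0" "D = 0" by linarith+
  then show ?thesis using 3 by (simp add: A_def B_def D_def)
qed

text \<open>By Newton's identities, the traces of the powers determine the characteristic polynomial and
  hence its factorization into a quadratic near \<open>\<lambda>\<^sup>2\<close> and one near \<open>\<lambda>\<^sup>2 + 1\<close>.\<close>

lemma A0_plus_damping_similar_imp_eq:
  fixes C C' X :: "real^4^4"
  assumes C: "invertible C" "s *\<^sub>R (A0 + damping_matrix \<Omega> \<delta>1 \<delta>2) = C ** X ** matrix_inv C"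
    and C': "invertible C'" "s' *\<^sub>R (A0 + damping_matrix \<Omega>' \<delta>1' \<delta>2') = C' ** X ** matrix_inv C'"
    and s: "s > 0" "s' > 0"
    and small: "\<bar>s * \<delta>1\<bar> \<le> 1/10" "\<bar>s\<^sup>2 * \<Omega>\<bar> \<le> 1/10" "\<bar>s * \<delta>2\<bar> \<le> 1/10" "\<bar>s\<^sup>2 - 1\<bar> \<le> 1/10"
      "\<bar>s' * \<delta>1'\<bar> \<le> 1/10" "\<bar>s'\<^sup>2 * \<Omega>'\<bar> \<le> 1/10" "\<bar>s' * \<delta>2'\<bar> \<le> 1/10" "\<bar>s'\<^sup>2 - 1\<bar> \<le> 1/10"
  shows "\<Omega> = \<Omega>' \<and> \<delta>1 = \<delta>1' \<and> \<delta>2 = \<delta>2'"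
proof -
  define a b c d where "a = s * \<delta>1" and "b = s\<^sup>2 * \<Omega>" and "c = s * \<delta>2" and "d = s\<^sup>2"
  define a' b' c' d' where "a' = s' * \<delta>1'" and "b' = s'\<^sup>2 * \<Omega>'" and "c' = s' * \<delta>2'" and "d' = s'\<^sup>2"
  note defs = a_def b_def c_def d_def a'_def b'_def c'_def d'_def
  note T = traces_scaled_A0_plus_damping[of s \<Omega> \<delta>1 \<delta>2, unfolded C(2) conjugate_mult[OF C(1)] trace_conjugate[OF C(1)],
      folded a_def b_def c_def d_def]
  note T' = traces_scaled_A0_plus_damping[of s' \<Omega>' \<delta>1' \<delta>2', unfolded C'(2) conjugate_mult[OF C'(1)] trace_conjugate[OF C'(1)],
      folded a'_def b'_def c'_def d'_def]
  have t1: "a + c = a' + c'"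
    using T(1) T'(1) by simp
  have t2: "a\<^sup>2 + c\<^sup>2 - 2 * b - 2 * d = a'\<^sup>2 + c'\<^sup>2 - 2 * b' - 2 * d'"
    using T(2) T'(2) by simp
  have t3: "3 * a * b + 3 * c * d - a ^ 3 - c ^ 3 = 3 * a' * b' + 3 * c' * d' - a' ^ 3 - c' ^ 3"
    using T(3) T'(3) by simp
  have t4: "a ^ 4 - 4 * a\<^sup>2 * b + 2 * b\<^sup>2 + c ^ 4 - 4 * c\<^sup>2 * d + 2 * d\<^sup>2
      = a' ^ 4 - 4 * a'\<^sup>2 * b' + 2 * b'\<^sup>2 + c' ^ 4 - 4 * c'\<^sup>2 * d' + 2 * d'\<^sup>2"
    using T(4) T'(4) by simp
  \<comment> \<open>Each identity expresses one coefficient by the preceding ones and one further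
    power sum, so the coefficients are compared in the order p2, p1, p0.\<close>
  have newton2: "2 * (b + d + a * c) = (a + c)\<^sup>2 - (a\<^sup>2 + c\<^sup>2 - 2 * b - 2 * d)" for a b c d :: real
    by (simp add: power2_eq_square power3_eq_cube power4_eq_xxxx algebra_simps)
  have newton3: "3 * (a * d + b * c) =
      3 * (a + c) * (b + d + a * c) - (a + c) ^ 3 - (3 * a * b + 3 * c * d - a ^ 3 - c ^ 3)" for a b c d :: real
    by (simp add: power2_eq_square power3_eq_cube power4_eq_xxxx algebra_simps)
  have newton4: "4 * (b * d) =
      (a + c) ^ 4 - 4 * (a + c)\<^sup>2 * (b + d + a * c) + 2 * (b + d + a * c)\<^sup>2 + 4 * (a + c) * (a * d + b * c)
      - (a ^ 4 - 4 * a\<^sup>2 * b + 2 * b\<^sup>2 + c ^ 4 - 4 * c\<^sup>2 * d + 2 * d\<^sup>2)" for a b c d :: real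
    by (simp add: power2_eq_square power3_eq_cube power4_eq_xxxx algebra_simps)
  have p2: "b + d + a * c = b' + d' + a' * c'"
  proof -
    have "2 * (b + d + a * c) = 2 * (b' + d' + a' * c')"
      unfolding newton2 unfolding t1 t2 ..
    then show ?thesis by simp
  qed
  have p1: "a * d + b * c = a' * d' + b' * c'"
  proof -
    have "3 * (a * d + b * c) = 3 * (a' * d' + b' * c')"
      unfolding newton3 unfolding t1 p2 t3 ..
    then show ?thesis by simp
  qed
  have p0: "b * d = b' * d'"
  proof -
    have "4 * (b * d) = 4 * (b' * d')"
      unfolding newton4[of b d a c] newton4[of b' d' a' c'] unfolding t1 p2 p1 t4 ..
    then show ?thesis by simp
  qed
  have "a = a' \<and> b = b' \<and> c = c' \<and> d = d'"
    by (rule quadratic_factors_unique[OF t1 p2 p1 p0]; unfold defs; rule small)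
  \<comment> \<open>The constant term d = s^2 reveals the time scale; positivity selects the root,
    and dividing by s and s^2 returns the parameters.\<close>
  moreover from this have "s = s'"
    using s by (simp add: defs)
  ultimately show ?thesis
    using s by (simp add: defs)
qed

section \<open>Continuity of germs and invariance of domain\<close>

text \<open>Invariance of domain needs continuity on an open set, hence the power series at every
  point a near the origin: f - f a vanishes at a, so it has small norm on a small box about
  a.\<close>

lemma real_analytic_germ_continuous_map:
  fixes f :: "(nat \<Rightarrow> real) \<Rightarrow> real"
  assumes "real_analytic_germ k f"
  obtains U where "openin (Euclidean_space k) U" "origin \<in> U"
    "continuous_map (subtopology (Euclidean_space k) U) euclideanreal f"
proof -
  obtain U where U: "openin (Euclidean_space k) U" "origin \<in> U"
    "\<And>a. a \<in> U \<Longrightarrow> \<exists>c. has_power_series_at k f a c"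
    using assms by (auto simp: real_analytic_germ_def)
  have "openin (Euclidean_space k) {x \<in> U. f x \<in> V}" if V: "open V" for V
  proof (subst openin_subopen, intro ballI)
    fix a assume "a \<in> {x \<in> U. f x \<in> V}"
    then have a: "a \<in> U" "f a \<in> V" by auto
    then have aE: "a \<in> topspace (Euclidean_space k)"
      using openin_subset[OF U(1)] by blast
    obtain e where e: "e > 0" "\<And>y. \<bar>y - f a\<bar> < e \<Longrightarrow> y \<in> V"
      using V a(2) by (auto simp: open_dist dist_real_def)
    obtain c r where r: "r > 0" "expands k a r c f"
      using U(3)[OF a(1)] has_power_series_at_imp_expands by metis
    then have "bounded_expansion k a r (wnorm k r c + \<bar>f a\<bar>) (\<lambda>x. f x - f a)"
      by (intro bounded_expansion_diff bounded_expansion_const) (auto simp: bounded_expansion_def)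
    then obtain r' where r': "r' > 0" "bounded_expansion k a r' (e / 2) (\<lambda>x. f x - f a)"
      by (rule bounded_expansion_shrink[where \<epsilon> = "e / 2"]) (use r e aE in auto)
    let ?T = "U \<inter> {x \<in> topspace (Euclidean_space k). \<forall>i<k. \<bar>x i - a i\<bar> < r'}"
    have "f x \<in> V" if "x \<in> ?T" for x
    proof (rule e(2))
      have "\<bar>f x - f a\<bar> \<le> e / 2"
        by (rule abs_le_bounded_expansion[OF r'(2)]) (use that in \<open>auto simp: polybox_def less_imp_le\<close>)
      then show "\<bar>f x - f a\<bar> < e" using e(1) by simp
    qed
    then show "\<exists>T. openin (Euclidean_space k) T \<and> a \<in> T \<and> T \<subseteq> {x \<in> U. f x \<in> V}"
      using a aE r'(1) U(1) by (intro exI[of _ ?T]) (auto intro: openin_open_polybox)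
  qed
  moreover have "{x \<in> topspace (subtopology (Euclidean_space k) U). f x \<in> V} = {x \<in> U. f x \<in> V}" for V
    using openin_subset[OF U(1)] by auto
  ultimately have "continuous_map (subtopology (Euclidean_space k) U) euclideanreal f"
    using U(1) by (auto simp: continuous_map_def openin_open_subtopology)
  with U that show ?thesis by blast
qed

lemma real_analytic_germs_continuous_map:
  fixes f :: "nat \<Rightarrow> (nat \<Rightarrow> real) \<Rightarrow> real"
  assumes "\<And>i. i < l \<Longrightarrow> real_analytic_germ k (f i)"
  shows "\<exists>U. openin (Euclidean_space k) U \<and> origin \<in> U \<and>
    (\<forall>i<l. continuous_map (subtopology (Euclidean_space k) U) euclideanreal (f i))"
  using assms
proof (induction l)
  case 0
  show ?case by (auto intro!: exI[of _ "topspace (Euclidean_space k)"])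
next
  case (Suc l)
  then obtain U where U: "openin (Euclidean_space k) U" "origin \<in> U"
    "\<And>i. i < l \<Longrightarrow> continuous_map (subtopology (Euclidean_space k) U) euclideanreal (f i)"
    by auto
  obtain V where V: "openin (Euclidean_space k) V" "origin \<in> V"
    "continuous_map (subtopology (Euclidean_space k) V) euclideanreal (f l)"
    using real_analytic_germ_continuous_map Suc.prems by (metis lessI)
  show ?case
    using U V by (intro exI[of _ "U \<inter> V"])
      (auto simp: less_Suc_eq intro: continuous_map_from_subtopology_mono)
qed

text \<open>If l < k, padding with zeros gives an injective continuous map of an open set into
  k-space, with image in the hyperplane where coordinate l is 0; such an image cannot be
  open.\<close>

lemma injective_real_analytic_map_germ_dim_le:
  assumes \<phi>: "real_analytic_map_germ k l \<phi>"
    and inj: "openin (Euclidean_space k) U" "origin \<in> U" "inj_on \<phi> U"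
  shows "k \<le> l"
proof (rule ccontr)
  assume "\<not> k \<le> l"
  then have l: "l < k" by simp
  obtain V where V: "openin (Euclidean_space k) V" "origin \<in> V" "\<And>x. x \<in> V \<Longrightarrow> \<phi> x \<in> topspace (Euclidean_space l)"
    using \<phi> by (auto simp: real_analytic_map_germ_def)
  obtain W where W: "openin (Euclidean_space k) W" "origin \<in> W"
    "\<And>i. i < l \<Longrightarrow> continuous_map (subtopology (Euclidean_space k) W) euclideanreal (\<lambda>x. \<phi> x i)"
    using real_analytic_germs_continuous_map[of l k "\<lambda>i x. \<phi> x i"] \<phi> by (auto simp: real_analytic_map_germ_def)
  let ?U = "U \<inter> V \<inter> W"
  let ?\<psi> = "\<lambda>x i. if i < k then (if i < l then \<phi> x i else 0) else 0"
  have eq: "?\<psi> x = \<phi> x" if "x \<in> ?U" for x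
    using V(3) that l by (auto simp: topspace_Euclidean_space fun_eq_iff)
  have "openin (Euclidean_space k) (?\<psi> ` ?U)"
  proof (rule invariance_of_domain_Euclidean_space)
    show "openin (Euclidean_space k) ?U"
      using inj V W by auto
    show "continuous_map (subtopology (Euclidean_space k) ?U) (Euclidean_space k) ?\<psi>"
      unfolding continuous_map_componentwise_Euclidean_space
    proof (intro allI impI)
      fix i
      show "continuous_map (subtopology (Euclidean_space k) ?U) euclideanreal (\<lambda>x. if i < l then \<phi> x i else 0)"
        by (cases "i < l") (auto intro: continuous_map_from_subtopology_mono[OF W(3)])
    qed
    show "inj_on ?\<psi> ?U"
      using inj(3) eq by (auto simp: inj_on_def)
  qed
  moreover have "origin \<in> ?\<psi> ` ?U"
    using eq[of origin] inj V W \<phi> by (auto simp: real_analytic_map_germ_def intro!: image_eqI[of _ _ origin])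
  ultimately obtain r where r: "r > 0" "polybox k origin r \<subseteq> ?\<psi> ` ?U"
    by (rule openin_contains_polybox)
  \<comment> \<open>This point of the box has coordinate l equal to r, where \<open>?\<psi>\<close>
    takes only the value 0.\<close>
  have "(\<lambda>i. if i < k then r else 0) \<in> polybox k origin r"
    using r(1) by (simp add: polybox_def origin_def topspace_Euclidean_space)
  then obtain x where "(\<lambda>i. if i < k then r else 0) = ?\<psi> x"
    using r(2) by blast
  from fun_cong[OF this, of l] show False
    using l r(1) by simp
qed

text \<open>Versality is applied to the three-parameter family itself. If two of its members have
  the same image under \<phi>, their rescalings are similar to the same matrix, so the members
  coincide.\<close>

lemma versal_A0_imp_ge_3:
  assumes "versal_up_to_time_rescaling A0 l A"
  shows "3 \<le> l"
proof -
  obtain \<phi> s C U where \<phi>: "real_analytic_map_germ 3 l \<phi>"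
    and s: "real_analytic_germ 3 s" "s origin = 1"
    and U: "openin (Euclidean_space 3) U" "origin \<in> U"
    and conj: "\<And>x. x \<in> U \<Longrightarrow> s x > 0 \<and> invertible (C x) \<and>
      s x *\<^sub>R (A0 + damping_matrix (x 0) (x 1) (x 2)) = C x ** A (\<phi> x) ** matrix_inv (C x)"
    using assms[unfolded versal_up_to_time_rescaling_def, THEN conjunct2, rule_format, OF deformation_A0_plus_damping]
    by blast
  \<comment> \<open>1/10 is the tolerance under which the quadratic factors are unique.\<close>
  have small: "eventually (\<lambda>x. \<bar>f x\<bar> \<le> 1/10) (nhds0 3)"
    if f: "real_analytic_germ 3 f" "f origin = 0" for f :: "(nat \<Rightarrow> real) \<Rightarrow> real"
  proof -
    obtain r where r: "r > 0" "bounded_expansion 3 origin r (1/10) f"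
      by (rule real_analytic_germ_small[OF f, of "1/10"]) auto
    then show ?thesis
      using abs_le_bounded_expansion[OF r(2)] by (intro eventually_mono[OF eventually_polybox[OF r(1)]])
  qed
  have "eventually (\<lambda>x. \<bar>s x * x 1\<bar> \<le> 1/10) (nhds0 3)" "eventually (\<lambda>x. \<bar>(s x)\<^sup>2 * x 0\<bar> \<le> 1/10) (nhds0 3)"
    "eventually (\<lambda>x. \<bar>s x * x 2\<bar> \<le> 1/10) (nhds0 3)" "eventually (\<lambda>x. \<bar>(s x)\<^sup>2 - 1\<bar> \<le> 1/10) (nhds0 3)"
    by (rule small; auto intro!: real_analytic_germ_intros s simp: s; simp add: origin_def)+
  then have "eventually (\<lambda>x. x \<in> U \<and> \<bar>s x * x 1\<bar> \<le> 1/10 \<and> \<bar>(s x)\<^sup>2 * x 0\<bar> \<le> 1/10 \<and> \<bar>s x * x 2\<bar> \<le> 1/10 \<and>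
      \<bar>(s x)\<^sup>2 - 1\<bar> \<le> 1/10) (nhds0 3)"
    using U by (intro eventually_conj) (auto simp: eventually_nhds0)
  then obtain V where V: "openin (Euclidean_space 3) V" "origin \<in> V"
    "\<And>x. x \<in> V \<Longrightarrow> x \<in> U \<and> \<bar>s x * x 1\<bar> \<le> 1/10 \<and> \<bar>(s x)\<^sup>2 * x 0\<bar> \<le> 1/10 \<and> \<bar>s x * x 2\<bar> \<le> 1/10 \<and>
      \<bar>(s x)\<^sup>2 - 1\<bar> \<le> 1/10"
    by (auto simp: eventually_nhds0)
  have "inj_on \<phi> V"
  proof (rule inj_onI)
    fix x y assume x: "x \<in> V" and y: "y \<in> V" and eq: "\<phi> x = \<phi> y"
    have "x 0 = y 0 \<and> x 1 = y 1 \<and> x 2 = y 2"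
    proof (rule A0_plus_damping_similar_imp_eq[where C = "C x" and C' = "C y" and X = "A (\<phi> x)" and s = "s x" and s' = "s y"])
      show "s x *\<^sub>R (A0 + damping_matrix (x 0) (x 1) (x 2)) = C x ** A (\<phi> x) ** matrix_inv (C x)"
        using conj V(3)[OF x] by blast
      show "s y *\<^sub>R (A0 + damping_matrix (y 0) (y 1) (y 2)) = C y ** A (\<phi> x) ** matrix_inv (C y)"
        using conj V(3)[OF y] unfolding eq by blast
    qed (use V(3)[OF x] V(3)[OF y] conj in auto)
    moreover have "x i = 0 \<and> y i = 0" if "i \<ge> 3" for i
      using that openin_subset[OF V(1)] x y by (auto simp: topspace_Euclidean_space)
    moreover have "i = 0 \<or> i = 1 \<or> i = 2 \<or> i \<ge> 3" for i :: nat
      by linarith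
    ultimately show "x = y"
      by (intro ext) metis
  qed
  then show ?thesis
    by (rule injective_real_analytic_map_germ_dim_le[OF \<phi> V(1,2)])
qed

section \<open>Relation between the two families\<close>

text \<open>A multi-index of degree below 2 splits only with one summand zero, and both constant
  terms vanish. The remainders below all have this product form.\<close>

lemma terms_of_order_at_least_2_mult:
  fixes f g :: "(nat \<Rightarrow> real) \<Rightarrow> real"
  assumes f: "real_analytic_germ k f" "f origin = 0" and g: "real_analytic_germ k g" "g origin = 0"
  shows "terms_of_order_at_least k 2 (\<lambda>x. f x * g x)"
proof -
  obtain r M N where r: "r > 0" "bounded_expansion k origin r M f" "bounded_expansion k origin r N g"
    by (rule real_analytic_germ_pair[OF f(1) g(1)])
  then obtain c d where c: "expands k origin r c f" and d: "expands k origin r d g"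
    by (auto simp: bounded_expansion_def)
  have "has_power_series_at k (\<lambda>x. f x * g x) origin (coeff_mult c d)"
    using expands_mult(1)[OF c d] r(1) by (intro expands_imp_has_power_series_at) auto
  moreover have "coeff_mult c d p = 0" if p: "p \<in> multi_indices k" "(\<Sum>i<k. p i) < 2" for p
    unfolding coeff_mult_def
  proof (rule sum.neutral, rule ballI)
    fix m assume "m \<in> {m. m \<le> p}"
    then have m: "\<And>i. m i \<le> p i" by (simp add: le_fun_def)
    let ?n = "\<lambda>i. p i - m i"
    have mk: "m \<in> multi_indices k" "?n \<in> multi_indices k"
      using p(1) m by (auto simp: multi_indices_def) (metis le_zero_eq)
    have "(\<Sum>i<k. m i) + (\<Sum>i<k. ?n i) = (\<Sum>i<k. p i)"
      using m by (simp add: sum.distrib[symmetric])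
    then have "(\<Sum>i<k. m i) = 0 \<or> (\<Sum>i<k. ?n i) = 0"
      using p(2) by linarith
    then have "m = (\<lambda>i. 0) \<or> ?n = (\<lambda>i. 0)"
      using multi_indices_sum_eq_0_iff mk by blast
    moreover have "c (\<lambda>i. 0) = 0" "d (\<lambda>i. 0) = 0"
      using expands_coeff_0[OF c] expands_coeff_0[OF d] r(1) f(2) g(2) by auto
    ultimately show "c m * d ?n = 0"
      by (elim disjE) simp_all
  qed
  ultimately show ?thesis
    unfolding terms_of_order_at_least_def by blast
qed

section \<open>The explicit change of parameters\<close>

definition triple :: "real \<Rightarrow> real \<Rightarrow> real \<Rightarrow> nat \<Rightarrow> real" where
  "triple a b c = (\<lambda>i. if i = 0 then a else if i = 1 then b else if i = 2 then c else 0)"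

lemma triple_simps [simp]:
  "triple a b c 0 = a" "triple a b c (Suc 0) = b" "triple a b c 2 = c"
  by (simp_all add: triple_def)

lemma triple_eta: "x \<in> topspace (Euclidean_space 3) \<Longrightarrow> triple (x 0) (x 1) (x 2) = x"
  by (auto simp: triple_def topspace_Euclidean_space fun_eq_iff)

lemma real_analytic_map_germ_triple:
  assumes "real_analytic_germ k f" "real_analytic_germ k g" "real_analytic_germ k h"
    and "f origin = 0" "g origin = 0" "h origin = 0"
  shows "real_analytic_map_germ k 3 (\<lambda>x. triple (f x) (g x) (h x))"
  unfolding real_analytic_map_germ_def
proof (intro conjI allI impI)
  show "triple (f origin) (g origin) (h origin) = origin"
    using assms by (auto simp: triple_def origin_def fun_eq_iff)
  show "\<exists>U. openin (Euclidean_space k) U \<and> origin \<in> U \<and>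
      (\<forall>x\<in>U. triple (f x) (g x) (h x) \<in> topspace (Euclidean_space 3))"
  proof (intro exI conjI ballI)
    show "triple (f x) (g x) (h x) \<in> topspace (Euclidean_space 3)" for x
      by (simp add: triple_def topspace_Euclidean_space)
  qed (rule openin_topspace origin_in_Euclidean_space)+
  show "real_analytic_germ k (\<lambda>x. triple (f x) (g x) (h x) i)" for i
    by (cases "i = 0"; cases "i = 1"; cases "i = 2") (simp_all add: triple_def assms real_analytic_germ_const)
qed

text \<open>Comparing characteristic polynomials gives \<open>s\<^sup>2 = 1 + \<alpha>\<^sub>3\<^sup>2\<close> and \<open>s * \<delta>2 = - 2 * \<alpha>\<^sub>3\<close>.\<close>

lemma damping_A0_family_conjugation:
  fixes T :: "real^4^4"
  assumes s: "s > 0" "s\<^sup>2 * (1 - \<delta>2\<^sup>2 / 4) = 1"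
    and T: "T = vector [vector [1, 0, 0, 0], vector [0, 1 / s, 0, 0],
      vector [0, 0, 1, s * \<delta>2 / 2], vector [0, 0, 0, - s]]"
  shows "invertible T"
    and "s *\<^sub>R (A0 + damping_matrix \<Omega> \<delta>1 \<delta>2) =
      T ** A0_family (- (s\<^sup>2 * \<Omega>)) (- (s * \<delta>1)) (- (s * \<delta>2 / 2)) ** matrix_inv T"
proof -
  \<comment> \<open>\<open>?T'\<close> is the inverse of \<open>T\<close>. The last column of
    \<open>T\<close> is forced by the rotation block: it is the scaled lower block minus \<alpha>3,
    applied to the third basis vector. Its entry -s reverses orientation, as the opposite sign of
    that block requires.\<close>
  let ?T' = "vector [vector [1, 0, 0, 0], vector [0, s, 0, 0],
      vector [0, 0, 1, \<delta>2 / 2], vector [0, 0, 0, - 1 / s]] :: real^4^4"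
  have "T ** ?T' = mat 1 \<and> ?T' ** T = mat 1"
    using s(1) by (simp add: T matrix_matrix_mult_def sum_4 vec_eq_iff forall_4 mat_def field_simps)
  then show inv: "invertible T"
    unfolding invertible_def by blast
  have s2: "s * s = 1 + (s * \<delta>2 / 2) * (s * \<delta>2 / 2)"
    using s(2) by (simp add: power2_eq_square algebra_simps)
  have "(s *\<^sub>R (A0 + damping_matrix \<Omega> \<delta>1 \<delta>2)) ** T =
      T ** A0_family (- (s\<^sup>2 * \<Omega>)) (- (s * \<delta>1)) (- (s * \<delta>2 / 2))"
    unfolding A0_plus_damping using s(1) s2
    by (simp add: T A0_family_def matrix_matrix_mult_def sum_4 vec_eq_iff forall_4 power2_eq_square)
      (simp add: field_simps)
  then show "s *\<^sub>R (A0 + damping_matrix \<Omega> \<delta>1 \<delta>2) =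
      T ** A0_family (- (s\<^sup>2 * \<Omega>)) (- (s * \<delta>1)) (- (s * \<delta>2 / 2)) ** matrix_inv T"
    by (rule conjugate_eqI[OF inv])
qed

text \<open>The factor s depends on \<delta>2 alone, so the third component is inverted in closed
  form and the other two by dividing by s^2 and s.\<close>

lemma damping_A0_family_reparametrization:
  "\<exists>(\<alpha> :: (nat \<Rightarrow> real) \<Rightarrow> (nat \<Rightarrow> real)) (s :: (nat \<Rightarrow> real) \<Rightarrow> real)
          (T :: (nat \<Rightarrow> real) \<Rightarrow> real^4^4).
        real_analytic_map_germ 3 3 \<alpha> \<and>
        (\<exists>\<beta>. real_analytic_map_germ 3 3 \<beta> \<and>
          (\<exists>U. openin (Euclidean_space 3) U \<and> origin \<in> U \<and>
            (\<forall>x\<in>U. \<beta> (\<alpha> x) = x \<and> \<alpha> (\<beta> x) = x))) \<and>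
        real_analytic_germ 3 s \<and> s origin = 1 \<and>
        real_analytic_germ 3 T \<and>
        (\<exists>U. openin (Euclidean_space 3) U \<and> origin \<in> U \<and>
          (\<forall>x\<in>U. s x > 0 \<and> invertible (T x) \<and>
            s x *\<^sub>R (A0 + damping_matrix (x 0) (x 1) (x 2)) =
              T x ** A0_family (\<alpha> x 0) (\<alpha> x 1) (\<alpha> x 2) ** matrix_inv (T x))) \<and>
        terms_of_order_at_least 3 2 (\<lambda>x. \<alpha> x 0 - (- x 0)) \<and>
        terms_of_order_at_least 3 2 (\<lambda>x. \<alpha> x 1 - (- x 1)) \<and>
        terms_of_order_at_least 3 2 (\<lambda>x. \<alpha> x 2 - (- (1/2) * x 2))"
proof -
  have coord: "real_analytic_germ 3 (\<lambda>x. x 0)" "real_analytic_germ 3 (\<lambda>x. x (Suc 0))" "real_analytic_germ 3 (\<lambda>x. x 2)"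
    by (auto intro: real_analytic_germ_coordinate)
  have o: "origin i = 0" for i by (simp add: origin_def)
  \<comment> \<open>This solves s^2 = 1 + \<alpha>3^2 with \<alpha>3 = -s \<delta>2 / 2.\<close>
  define s where "s x = 1 / sqrt (1 - (x 2)\<^sup>2 / 4)" for x :: "nat \<Rightarrow> real"
  \<comment> \<open>For the inverse map x holds the values of \<alpha>, and this is 1 / s expressed
    by \<alpha>3.\<close>
  define S where "S x = 1 / sqrt (1 + (x 2)\<^sup>2)" for x :: "nat \<Rightarrow> real"
  have "real_analytic_germ 3 (\<lambda>x. 1 - (x 2)\<^sup>2 * (1/4))"
    by (intro real_analytic_germ_intros) simp
  then have s: "real_analytic_germ 3 s" "s origin = 1"
    unfolding s_def
    by (auto intro!: real_analytic_germ_divide real_analytic_germ_const real_analytic_germ_sqrt simp: o)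
  have "real_analytic_germ 3 (\<lambda>x. 1 + (x 2)\<^sup>2)"
    by (intro real_analytic_germ_intros) simp
  then have S: "real_analytic_germ 3 S"
    unfolding S_def
    by (auto intro!: real_analytic_germ_divide real_analytic_germ_const real_analytic_germ_sqrt simp: o)
  define \<alpha> where "\<alpha> x = triple (- ((s x)\<^sup>2 * x 0)) (- (s x * x 1)) (- (s x * x 2 / 2))" for x
  define \<beta> where "\<beta> x = triple (- ((S x)\<^sup>2 * x 0)) (- (S x * x 1)) (- (2 * S x * x 2))" for x
  define T :: "(nat \<Rightarrow> real) \<Rightarrow> real^4^4" where
    "T x = vector [vector [1, 0, 0, 0], vector [0, 1 / s x, 0, 0],
      vector [0, 0, 1, s x * x 2 / 2], vector [0, 0, 0, - s x]]" for x
  have half: "real_analytic_germ 3 (\<lambda>x. s x * x 2 / 2)"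
    using real_analytic_germ_mult[OF real_analytic_germ_mult[OF s(1) coord(3)] real_analytic_germ_const[of 3 "1/2"]]
    by simp
  have \<alpha>: "real_analytic_map_germ 3 3 \<alpha>"
    unfolding \<alpha>_def
    by (rule real_analytic_map_germ_triple) (simp_all add: real_analytic_germ_intros s half coord o)
  have \<beta>: "real_analytic_map_germ 3 3 \<beta>"
    unfolding \<beta>_def
    by (rule real_analytic_map_germ_triple) (simp_all add: real_analytic_germ_intros S coord o)
  have "\<forall>i j. real_analytic_germ 3 (\<lambda>x. T x $ i $ j)"
    by (simp add: T_def forall_4 real_analytic_germ_intros real_analytic_germ_divide s half)
  then have T: "real_analytic_germ 3 T"
    by (intro real_analytic_germ_matrix) auto
  \<comment> \<open>The bound on \<delta>2 keeps 1 - \<delta>2^2 / 4 positive.\<close>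
  have small: "eventually (\<lambda>x. x \<in> topspace (Euclidean_space 3) \<and> \<bar>x 2\<bar> \<le> 1) (nhds0 3)"
    by (rule eventually_mono[OF eventually_polybox[of 1 3]]) (auto simp: polybox_def o)
  have s_pos: "s x > 0" and s_eq: "(s x)\<^sup>2 * (1 - (x 2)\<^sup>2 / 4) = 1" if "\<bar>x 2\<bar> \<le> 1" for x
  proof -
    have "(x 2)\<^sup>2 \<le> 1" using that by (simp add: abs_square_le_1)
    then have "1 - (x 2)\<^sup>2 / 4 > 0" by simp
    then show "s x > 0" "(s x)\<^sup>2 * (1 - (x 2)\<^sup>2 / 4) = 1"
      by (simp_all add: s_def power_divide)
  qed
  have S_pos: "S x > 0" and S_eq: "(S x)\<^sup>2 * (1 + (x 2)\<^sup>2) = 1" for x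
  proof -
    have "1 + (x 2)\<^sup>2 > 0" by (simp add: add_pos_nonneg)
    then show "S x > 0" "(S x)\<^sup>2 * (1 + (x 2)\<^sup>2) = 1"
      by (simp_all add: S_def power_divide)
  qed
  have \<beta>\<alpha>: "\<beta> (\<alpha> x) = x" if "x \<in> topspace (Euclidean_space 3)" "\<bar>x 2\<bar> \<le> 1" for x
  proof -
    have "1 + (\<alpha> x 2)\<^sup>2 = (s x)\<^sup>2"
      using s_eq[of x, OF that(2)] by (simp add: \<alpha>_def power_mult_distrib power_divide algebra_simps)
    then have "S (\<alpha> x) = 1 / s x"
      using s_pos[of x, OF that(2)] by (simp add: S_def)
    then have "\<beta> (\<alpha> x) = triple (x 0) (x 1) (x 2)"
      using s_pos[of x, OF that(2)] by (simp add: \<beta>_def \<alpha>_def power_divide)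
    then show ?thesis using triple_eta[OF that(1)] by simp
  qed
  have \<alpha>\<beta>: "\<alpha> (\<beta> x) = x" if "x \<in> topspace (Euclidean_space 3)" for x
  proof -
    have "1 - (\<beta> x 2)\<^sup>2 / 4 = (S x)\<^sup>2"
      using S_eq[of x] by (simp add: \<beta>_def power_mult_distrib algebra_simps)
    then have "s (\<beta> x) = 1 / S x"
      using S_pos[of x] by (simp add: s_def)
    then have "\<alpha> (\<beta> x) = triple (x 0) (x 1) (x 2)"
      using S_pos[of x] by (simp add: \<beta>_def \<alpha>_def power_divide)
    then show ?thesis using triple_eta[OF that(1)] by simp
  qed
  have inverse: "\<exists>U. openin (Euclidean_space 3) U \<and> origin \<in> U \<and> (\<forall>x\<in>U. \<beta> (\<alpha> x) = x \<and> \<alpha> (\<beta> x) = x)"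
    unfolding eventually_nhds0[symmetric]
    by (rule eventually_mono[OF small]) (simp add: \<beta>\<alpha> \<alpha>\<beta>)
  have conjugate: "\<exists>U. openin (Euclidean_space 3) U \<and> origin \<in> U \<and>
          (\<forall>x\<in>U. s x > 0 \<and> invertible (T x) \<and>
            s x *\<^sub>R (A0 + damping_matrix (x 0) (x 1) (x 2)) =
              T x ** A0_family (\<alpha> x 0) (\<alpha> x 1) (\<alpha> x 2) ** matrix_inv (T x))"
    unfolding eventually_nhds0[symmetric]
  proof (rule eventually_mono[OF small])
    fix x :: "nat \<Rightarrow> real" assume "x \<in> topspace (Euclidean_space 3) \<and> \<bar>x 2\<bar> \<le> 1"
    then have x: "\<bar>x 2\<bar> \<le> 1" by simp
    show "s x > 0 \<and> invertible (T x) \<and> s x *\<^sub>R (A0 + damping_matrix (x 0) (x 1) (x 2)) =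
              T x ** A0_family (\<alpha> x 0) (\<alpha> x 1) (\<alpha> x 2) ** matrix_inv (T x)"
      using damping_A0_family_conjugation[OF s_pos[of x, OF x] s_eq[of x, OF x] T_def] s_pos[of x, OF x]
      by (simp add: \<alpha>_def)
  qed
  \<comment> \<open>Each remainder is a coordinate times a germ that vanishes because s is 1 at the
    origin.\<close>
  have "terms_of_order_at_least 3 2 (\<lambda>x. x 0 * (1 - (s x)\<^sup>2))"
    "terms_of_order_at_least 3 2 (\<lambda>x. x (Suc 0) * (1 - s x))"
    "terms_of_order_at_least 3 2 (\<lambda>x. x 2 * ((1 - s x) * (1/2)))"
    by (rule terms_of_order_at_least_2_mult; simp add: real_analytic_germ_intros real_analytic_germ_divide s coord o)+
  then have "terms_of_order_at_least 3 2 (\<lambda>x. \<alpha> x 0 - (- x 0))"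
    "terms_of_order_at_least 3 2 (\<lambda>x. \<alpha> x 1 - (- x 1))"
    "terms_of_order_at_least 3 2 (\<lambda>x. \<alpha> x 2 - (- (1/2) * x 2))"
    by (simp_all add: \<alpha>_def algebra_simps diff_divide_distrib)
  then show ?thesis
    using \<alpha> \<beta> s T inverse conjugate by blast
qed

theorem mainTheorem1:
  shows "miniversal_up_to_time_rescaling A0 3 (\<lambda>x. A0 + damping_matrix (x 0) (x 1) (x 2))
    \<and> (LEAST l. \<exists>A. versal_up_to_time_rescaling A0 l A) = 3
    \<and> (\<exists>(\<alpha> :: (nat \<Rightarrow> real) \<Rightarrow> (nat \<Rightarrow> real)) (s :: (nat \<Rightarrow> real) \<Rightarrow> real)
          (T :: (nat \<Rightarrow> real) \<Rightarrow> real^4^4).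
        real_analytic_map_germ 3 3 \<alpha> \<and>
        (\<exists>\<beta>. real_analytic_map_germ 3 3 \<beta> \<and>
          (\<exists>U. openin (Euclidean_space 3) U \<and> origin \<in> U \<and>
            (\<forall>x\<in>U. \<beta> (\<alpha> x) = x \<and> \<alpha> (\<beta> x) = x))) \<and>
        real_analytic_germ 3 s \<and> s origin = 1 \<and>
        real_analytic_germ 3 T \<and>
        (\<exists>U. openin (Euclidean_space 3) U \<and> origin \<in> U \<and>
          (\<forall>x\<in>U. s x > 0 \<and> invertible (T x) \<and>
            s x *\<^sub>R (A0 + damping_matrix (x 0) (x 1) (x 2)) =
              T x ** A0_family (\<alpha> x 0) (\<alpha> x 1) (\<alpha> x 2) ** matrix_inv (T x))) \<and>
        terms_of_order_at_least 3 2 (\<lambda>x. \<alpha> x 0 - (- x 0)) \<and>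
        terms_of_order_at_least 3 2 (\<lambda>x. \<alpha> x 1 - (- x 1)) \<and>
        terms_of_order_at_least 3 2 (\<lambda>x. \<alpha> x 2 - (- (1/2) * x 2)))"
proof (intro conjI)
  show "miniversal_up_to_time_rescaling A0 3 (\<lambda>x. A0 + damping_matrix (x 0) (x 1) (x 2))"
    using versal_A0_plus_damping versal_A0_imp_ge_3 by (auto simp: miniversal_up_to_time_rescaling_def)
  show "(LEAST l. \<exists>A. versal_up_to_time_rescaling A0 l A) = 3"
    using versal_A0_plus_damping versal_A0_imp_ge_3 by (intro Least_equality) auto
qed (rule damping_A0_family_reparametrization)

end
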